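(* Let $X$ and $Y$ be Polish spaces, $\mu\in\mathcal{P}(X)$, $\nu\in\mathcal{P}(Y)$, and let $c\colon X\times Y\to\mathbb{R}_+$ be continuous with $T_c(\mu,\nu)<\infty$. Let $\mathrm{supp}\,\mu=\bigcup_{i\in I}X_i$ and $\mathrm{supp}\,\nu=\bigcup_{j\in J}Y_j$ be the decompositions into (pairwise disjoint) connected components, and assume that $I$ and $J$ are at most countable. Suppose there exists a non-degenerate optimal transport plan $\pi\in\mathcal{C}(\mu,\nu)$ with respect to which the Kantorovich potentials $S_{c_{X_i}}(\mu_{X_i},\nu_{X_i})$ of the $X_i$-restricted problem are unique for all $i\in I$ with $\mu(X_i)>0$. Suppose furthermore that one of the following holds: 1) for all $f\in S_c(\mu,\nu)$ and all $j\in J$ with $\nu(Y_j)>0$, the restriction $f^c|_{Y_j}$ is continuous and $\mathrm{supp}(\nu|_{Y_j})$ is connected; and $\big|\{i\in I\mid\pi(X_i\times Y_j)>0\}\big|<\infty$ for all $j\in J$; 2) $Y_j$ consists of a single point for each $j\in J$ with $\nu(Y_j)>0$ (in this case, the requirement that $f^c|_{Y_j}$ is continuous and $\mathrm{supp}(\nu|_{Y_j})$ is connected for all $f\in S_c(\mu,\nu)$ and all $j\in J$ with $\nu(Y_j)>0$ is always satisfied). Then the Kantorovich potentials $S_c(\mu,\nu)$ are unique.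
   Context: $\mathcal{P}(X)$ is the set of Borel probability measures on $X$; $\mathcal{C}(\mu,\nu)$ is the set of probability measures on $X\times Y$ with marginals $\mu,\nu$ (transport plans); $T_c(\mu,\nu)=\inf_{\pi\in\mathcal{C}(\mu,\nu)}\int c\,\mathrm{d}\pi$, and $\pi$ is optimal if it attains this infimum. The support of a measure is the smallest closed set of full measure. $c$-transforms: for $g\colon Y\to\mathbb{R}\cup\{-\infty\}$ set $g^c(x)=\inf_{y\in Y}c(x,y)-g(y)$, and for $f\colon X\to\mathbb{R}\cup\{-\infty\}$ set $f^c(y)=\inf_{x\in X}c(x,y)-f(x)$; these are functions with values in $\mathbb{R}\cup\{-\infty\}$. A function $f\colon X\to\mathbb{R}\cup\{-\infty\}$ is $c$-concave on $X$ if $f=g^c$ for some $g\colon Y\to\mathbb{R}\cup\{-\infty\}$ and $f$ is not identically $-\infty$. A (generalized) Kantorovich potential is a $c$-concave function $f$ on $X$ such that $T_c(\mu,\nu)=\int c\,\mathrm{d}\pi=\int\big(f(x)+f^c(y)\big)\,\mathrm{d}\pi(x,y)$ for an optimal plan $\pi$ (equivalently, for every optimal plan). The set of these is denoted $S_c(\mu,\nu)$; $f$ and $f^c$ need not be integrable individually. Kantorovich potentials $S_c(\mu,\nu)$ are called unique if $f_1-f_2$ is $\mu$-almost surely constant for all $f_1,f_2\in S_c(\mu,\nu)$; the same definitions apply to restricted problems with the respective spaces, measures and costs. Restricted problem: given an optimal plan $\pi\in\mathcal{C}(\mu,\nu)$ and a closed $\tilde X\subset X$ with $\mu(\tilde X)>0$,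 the $\tilde X$-restricted problem (with respect to $\pi$) is the optimal transport problem between $\mu_{\tilde X}=\mu|_{\tilde X}/\mu(\tilde X)$ and $\nu_{\tilde X}=\pi(\tilde X\times\cdot)/\mu(\tilde X)$ under the cost $c_{\tilde X}=c|_{\tilde X\times Y}$. Degenerate plans: a transport plan $\pi\in\mathcal{C}(\mu,\nu)$ is degenerate (with respect to the decompositions into connected components) if there exist $I'\subset I$ and $J'\subset J$ with $$0<\sum_{i\in I'}\mu(X_i)=\sum_{i\in I'}\sum_{j\in J'}\pi(X_i\times Y_j)=\sum_{j\in J'}\nu(Y_j)<1;$$ otherwise it is non-degenerate.
   Formalization: In condition 1), "f^c restricted to Y_j is continuous" is taken to mean finite (real-valued) and continuous on Y_j; if the value -∞ were allowed, the claim would fail, since two potentials could differ by different constants on the two sides of a point where f^c = -∞. *)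

theory Defs
  imports "HOL-Probability.Probability"
begin

text \<open>
  The two spaces of a transport problem are the sets \<open>space \<mu>\<close> and \<open>space \<nu>\<close>, with the Borel
  \<open>\<sigma>\<close>-algebra of the subspace topology. They are all of the ambient types for the full problem, and a
  closed subset \<open>A\<close> in place of the first one for a restricted problem. A cost on
  \<open>space \<mu> \<times> space \<nu>\<close> is a function on the ambient product type of which only the values on
  \<open>space \<mu> \<times> space \<nu>\<close> matter, so that restricting a cost needs no separate operation.
\<close>

text \<open>
  Relative to the space of the measure. On a second countable space this intersection has itself
  full measure, so it is the smallest closed set of full measure.
\<close>

definition msupport :: "'a::topological_space measure \<Rightarrow> 'a set" where
  "msupport M = \<Inter>{F. closedin (top_of_set (space M)) F \<and> emeasure M F = emeasure M (space M)}"

definition transport_plans :: "'a measure \<Rightarrow> 'b measure \<Rightarrow> ('a \<times> 'b) measure set" where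
  "transport_plans \<mu> \<nu> =
     {\<pi>. prob_space \<pi> \<and> sets \<pi> = sets (\<mu> \<Otimes>\<^sub>M \<nu>) \<and> distr \<pi> \<mu> fst = \<mu> \<and> distr \<pi> \<nu> snd = \<nu>}"

definition transport_cost :: "('a \<times> 'b \<Rightarrow> real) \<Rightarrow> 'a measure \<Rightarrow> 'b measure \<Rightarrow> ennreal" where
  "transport_cost c \<mu> \<nu> = (INF \<pi>\<in>transport_plans \<mu> \<nu>. \<integral>\<^sup>+z. ennreal (c z) \<partial>\<pi>)"

definition optimal_plan ::
  "('a \<times> 'b \<Rightarrow> real) \<Rightarrow> 'a measure \<Rightarrow> 'b measure \<Rightarrow> ('a \<times> 'b) measure \<Rightarrow> bool" where
  "optimal_plan c \<mu> \<nu> \<pi> \<longleftrightarrow>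
     \<pi> \<in> transport_plans \<mu> \<nu> \<and> (\<integral>\<^sup>+z. ennreal (c z) \<partial>\<pi>) = transport_cost c \<mu> \<nu>"

text \<open>
  The \<open>c\<close>-transforms of \<open>g\<close> on \<open>B\<close> and of \<open>f\<close> on \<open>A\<close>. The functions transformed never take the
  value \<open>\<infinity>\<close> on their domain, so no difference is of the form \<open>\<infinity> - \<infinity>\<close>. The transform of a
  function that is identically \<open>-\<infinity>\<close> is identically \<open>\<infinity>\<close>; \<open>c_concave\<close> excludes it.
\<close>

definition ctransform_fst :: "('a \<times> 'b \<Rightarrow> real) \<Rightarrow> 'b set \<Rightarrow> ('b \<Rightarrow> ereal) \<Rightarrow> 'a \<Rightarrow> ereal" where
  "ctransform_fst c B g x = (INF y\<in>B. ereal (c (x, y)) - g y)"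

definition ctransform_snd :: "('a \<times> 'b \<Rightarrow> real) \<Rightarrow> 'a set \<Rightarrow> ('a \<Rightarrow> ereal) \<Rightarrow> 'b \<Rightarrow> ereal" where
  "ctransform_snd c A f y = (INF x\<in>A. ereal (c (x, y)) - f x)"

definition c_concave ::
  "('a \<times> 'b \<Rightarrow> real) \<Rightarrow> 'a set \<Rightarrow> 'b set \<Rightarrow> ('a \<Rightarrow> ereal) \<Rightarrow> bool" where
  "c_concave c A B f \<longleftrightarrow>
     (\<forall>x\<in>A. f x \<noteq> \<infinity>) \<and>
     (\<exists>g. (\<forall>y\<in>B. g y \<noteq> \<infinity>) \<and> (\<forall>x\<in>A. f x = ctransform_fst c B g x)) \<and>
     (\<exists>x\<in>A. f x \<noteq> -\<infinity>)"

text \<open>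
  Integral of an extended real function as positive part minus negative part; meaningful as soon as
  one of the two is finite. It is applied below to functions bounded above by the cost, whose
  positive part has a finite integral when the optimal cost is finite.
\<close>

definition ereal_integral :: "'a measure \<Rightarrow> ('a \<Rightarrow> ereal) \<Rightarrow> ereal" where
  "ereal_integral M h =
     enn2ereal (\<integral>\<^sup>+z. e2ennreal (h z) \<partial>M) - enn2ereal (\<integral>\<^sup>+z. e2ennreal (- h z) \<partial>M)"

definition kantorovich_potentials ::
  "('a \<times> 'b \<Rightarrow> real) \<Rightarrow> 'a measure \<Rightarrow> 'b measure \<Rightarrow> ('a \<Rightarrow> ereal) set" where
  "kantorovich_potentials c \<mu> \<nu> =
     {f. c_concave c (space \<mu>) (space \<nu>) f \<and>
         (\<exists>\<pi>. optimal_plan c \<mu> \<nu> \<pi> \<and>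
              enn2ereal (transport_cost c \<mu> \<nu>) =
                ereal_integral \<pi> (\<lambda>(x, y). f x + ctransform_snd c (space \<mu>) f y))}"

definition unique_potentials ::
  "('a \<times> 'b \<Rightarrow> real) \<Rightarrow> 'a measure \<Rightarrow> 'b measure \<Rightarrow> bool" where
  "unique_potentials c \<mu> \<nu> \<longleftrightarrow>
     (\<forall>f1\<in>kantorovich_potentials c \<mu> \<nu>. \<forall>f2\<in>kantorovich_potentials c \<mu> \<nu>.
        \<exists>a::real. AE x in \<mu>. f1 x - f2 x = ereal a)"

text \<open>The marginals of the \<open>A\<close>-restricted problem with respect to the plan \<open>\<pi>\<close>.\<close>

definition restricted_fst :: "'a measure \<Rightarrow> 'a set \<Rightarrow> 'a measure" where
  "restricted_fst \<mu> A = scale_measure (inverse (emeasure \<mu> A)) (restrict_space \<mu> A)"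

definition restricted_snd ::
  "'a measure \<Rightarrow> 'b measure \<Rightarrow> ('a \<times> 'b) measure \<Rightarrow> 'a set \<Rightarrow> 'b measure" where
  "restricted_snd \<mu> \<nu> \<pi> A =
     scale_measure (inverse (emeasure \<mu> A))
       (distr (restrict_space \<pi> (A \<times> space \<nu>)) \<nu> snd)"

lemma emeasure_restricted_snd:
  assumes "\<pi> \<in> transport_plans \<mu> \<nu>" "A \<in> sets \<mu>" "B \<in> sets \<nu>"
  shows "emeasure (restricted_snd \<mu> \<nu> \<pi> A) B = emeasure \<pi> (A \<times> B) / emeasure \<mu> A"
proof -
  have sets: "sets \<pi> = sets (\<mu> \<Otimes>\<^sub>M \<nu>)"
    using assms(1) by (simp add: transport_plans_def)
  have sp: "A \<times> space \<nu> \<in> sets \<pi>"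
    using assms(2) sets by simp
  have "snd \<in> restrict_space \<pi> (A \<times> space \<nu>) \<rightarrow>\<^sub>M \<nu>"
    by (rule measurable_restrict_space1)
       (simp add: measurable_cong_sets[OF sets refl])
  moreover have "snd -` B \<inter> space (restrict_space \<pi> (A \<times> space \<nu>)) = A \<times> B"
    using sets.sets_into_space[OF assms(2)] sets.sets_into_space[OF assms(3)]
      sets_eq_imp_space_eq[OF sets]
    by (auto simp: space_restrict_space space_pair_measure)
  moreover have "A \<times> B \<subseteq> A \<times> space \<nu>"
    using sets.sets_into_space[OF assms(3)] by auto
  ultimately show ?thesis
    using assms(3) sp
    by (simp add: restricted_snd_def emeasure_distr emeasure_restrict_space
        divide_ennreal_def mult.commute)
qed

text \<open>
  The connected components are indexed by themselves, so the subsets \<open>I'\<close> and \<open>J'\<close> of the index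
  sets are sets of components.
\<close>

definition degenerate_plan ::
  "'a::topological_space measure \<Rightarrow> 'b::topological_space measure \<Rightarrow> ('a \<times> 'b) measure \<Rightarrow> bool" where
  "degenerate_plan \<mu> \<nu> \<pi> \<longleftrightarrow>
     (\<exists>I' J'. I' \<subseteq> components (msupport \<mu>) \<and> J' \<subseteq> components (msupport \<nu>) \<and>
        0 < (\<Sum>\<^sub>\<infinity>A\<in>I'. emeasure \<mu> A) \<and>
        (\<Sum>\<^sub>\<infinity>A\<in>I'. emeasure \<mu> A) = (\<Sum>\<^sub>\<infinity>A\<in>I'. \<Sum>\<^sub>\<infinity>B\<in>J'. emeasure \<pi> (A \<times> B)) \<and>
        (\<Sum>\<^sub>\<infinity>A\<in>I'. \<Sum>\<^sub>\<infinity>B\<in>J'. emeasure \<pi> (A \<times> B)) = (\<Sum>\<^sub>\<infinity>B\<in>J'. emeasure \<nu> B) \<and>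
        (\<Sum>\<^sub>\<infinity>B\<in>J'. emeasure \<nu> B) < 1)"

text \<open>
  Continuity of a function on \<open>S\<close> as a real-valued function. Continuity into \<open>[-\<infinity>, \<infinity>)\<close> would not
  be enough: a transform may tend to \<open>-\<infinity>\<close> at a point that cuts the connected set \<open>S\<close>, and two
  potentials may then differ by different constants on the two sides.
\<close>

definition real_continuous_on :: "'a::topological_space set \<Rightarrow> ('a \<Rightarrow> ereal) \<Rightarrow> bool" where
  "real_continuous_on S h \<longleftrightarrow> (\<forall>y\<in>S. \<bar>h y\<bar> \<noteq> \<infinity>) \<and> continuous_on S h"

definition regular_transforms ::
  "('a::topological_space \<times> 'b::topological_space \<Rightarrow> real) \<Rightarrow> 'a measure \<Rightarrow> 'b measure \<Rightarrow> bool" where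
  "regular_transforms c \<mu> \<nu> \<longleftrightarrow>
     (\<forall>f\<in>kantorovich_potentials c \<mu> \<nu>. \<forall>B\<in>components (msupport \<nu>). emeasure \<nu> B > 0 \<longrightarrow>
        real_continuous_on B (ctransform_snd c (space \<mu>) f) \<and>
        connected (msupport (restrict_space \<nu> B)))"

end

theory Submission
  imports Defs
begin

text \<open>
  A potential \<open>f\<close> satisfies \<open>f(x) + f\<^sup>c(y) = c(x, y)\<close> almost surely under every optimal plan and hence
  restricts to a potential of each restricted problem. Given two potentials, their difference is thus
  a constant \<open>a\<^sub>A\<close> on each non-null component \<open>A\<close> of the first support, and the difference of their
  transforms is \<open>-a\<^sub>A\<close> at almost every point that \<open>\<pi>\<close> couples with \<open>A\<close>. On a component \<open>B\<close> of the
  second support the latter difference is continuous and takes finitely many values on a connected set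
  of full measure (or \<open>B\<close> is a single point), so it is a constant \<open>-b\<^sub>B\<close>. Hence \<open>a\<^sub>A = b\<^sub>B\<close> whenever \<open>\<pi>\<close> charges \<open>A \<times> B\<close>, and if
  the constants were not all equal, the components with one particular value would show that \<open>\<pi>\<close> is
  degenerate.
\<close>

subsection \<open>Supports and almost everywhere statements\<close>

text \<open>Countable additivity for the unordered sums that occur in
  \<open>degenerate_plan\<close>. Such a sum is the supremum of its finite partial sums, and these
  are the measures of finite subunions.\<close>

lemma emeasure_Union_infsum:
  assumes "countable I" "\<And>A. A \<in> I \<Longrightarrow> X A \<in> sets M" "disjoint_family_on X I"
  shows "(\<Sum>\<^sub>\<infinity>A\<in>I. emeasure M (X A)) = emeasure M (\<Union>A\<in>I. X A)"
proof (cases "I = {}")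
  case False
  have fin: "sum (\<lambda>A. emeasure M (X A)) F = emeasure M (\<Union>A\<in>F. X A)" if "finite F" "F \<subseteq> I" for F
    using that assms(2,3) by (intro sum_emeasure) (auto intro: disjoint_family_on_mono)
  have SUP: "(\<Sum>\<^sub>\<infinity>A\<in>I. emeasure M (X A)) =
      (SUP F\<in>{F. finite F \<and> F \<subseteq> I}. emeasure M (\<Union>A\<in>F. X A))"
    by (subst nonneg_infsum_complete) (auto intro!: SUP_cong simp: fin)
  \<comment> \<open>The enumeration \<open>from_nat_into I\<close> repeats members when
    \<open>I\<close> is finite. Working with images of initial segments makes the repetitions
    harmless.\<close>
  have UN: "(\<Union>A\<in>I. X A) = (\<Union>n. \<Union>A\<in>from_nat_into I ` {..<n}. X A)"
  proof (intro equalityI subsetI)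
    fix x assume "x \<in> (\<Union>A\<in>I. X A)"
    then obtain A where "A \<in> I" "x \<in> X A" by blast
    moreover obtain n where "from_nat_into I n = A"
      using from_nat_into_surj[OF assms(1) \<open>A \<in> I\<close>] by blast
    ultimately show "x \<in> (\<Union>n. \<Union>A\<in>from_nat_into I ` {..<n}. X A)"
      by (intro UN_I[of "Suc n"] UN_I[of A]) auto
  qed (use from_nat_into[OF False] in auto)
  have "emeasure M (\<Union>A\<in>I. X A) = (SUP n. emeasure M (\<Union>A\<in>from_nat_into I ` {..<n}. X A))"
    unfolding UN using False assms(2)
    by (intro SUP_emeasure_incseq[symmetric])
      (auto simp: incseq_def intro!: sets.finite_UN from_nat_into dest: less_le_trans)
  also have "\<dots> \<le> (\<Sum>\<^sub>\<infinity>A\<in>I. emeasure M (X A))"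
    unfolding SUP using False by (intro SUP_mono) (auto intro: from_nat_into)
  finally have "emeasure M (\<Union>A\<in>I. X A) \<le> (\<Sum>\<^sub>\<infinity>A\<in>I. emeasure M (X A))" .
  moreover have "(\<Sum>\<^sub>\<infinity>A\<in>I. emeasure M (X A)) \<le> emeasure M (\<Union>A\<in>I. X A)"
    unfolding SUP using assms(1,2) by (intro SUP_least emeasure_mono sets.countable_UN') auto
  ultimately show ?thesis by simp
qed simp

lemma closedin_msupport: "closedin (top_of_set (space M)) (msupport M)"
  unfolding msupport_def by (rule closedin_Inter) auto

text \<open>The intersection defining the support may be uncountable. By Lindelof's theorem
  countably many of the complements, each a null set, already cover the complement of the support.
  The set \<open>S\<close> allows for measures living on a subspace, such as a restriction to a
  component.\<close>

lemma AE_msupport: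
  fixes M :: "'a::second_countable_topology measure"
  assumes "finite_measure M" and sets: "sets M = sets (restrict_space borel S)"
  shows "AE x in M. x \<in> msupport M"
proof -
  interpret finite_measure M by fact
  have S: "space M = S"
    using sets_eq_imp_space_eq[OF sets] by (simp add: space_restrict_space)
  define \<F> where "\<F> = {F. closedin (top_of_set S) F \<and> emeasure M F = emeasure M S}"
  obtain \<G> where \<G>: "\<G> \<subseteq> (\<lambda>F. S - F) ` \<F>" "countable \<G>" "\<Union>\<G> = \<Union>((\<lambda>F. S - F) ` \<F>)"
  proof (rule Lindelof_openin[of "(\<lambda>F. S - F) ` \<F>" S])
    show "openin (top_of_set S) G" if "G \<in> (\<lambda>F. S - F) ` \<F>" for G
      using that by (auto simp: \<F>_def openin_diff)
  qed (rule that)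
  have "AE x in M. x \<notin> G" if G: "G \<in> \<G>" for G
  proof -
    obtain F where F: "F \<in> \<F>" "G = S - F" using G \<G>(1) by auto
    then obtain T where T: "closed T" "F = S \<inter> T"
      by (auto simp: \<F>_def closedin_closed)
    have "F \<in> sets M"
      unfolding sets T sets_restrict_space using T(1) by auto
    then have "emeasure M (space M - F) = emeasure M (space M) - emeasure M F"
      by (intro emeasure_compl) auto
    also have "\<dots> = 0" using F(1) S by (simp add: \<F>_def)
    finally show ?thesis
      using F(2) S \<open>F \<in> sets M\<close> by (intro AE_not_in) auto
  qed
  then have "AE x in M. \<forall>G\<in>\<G>. x \<notin> G"
    by (subst AE_ball_countable[OF \<G>(2)]) auto
  then show ?thesis
  proof (rule AE_mp, intro AE_I2 impI)
    fix x assume "x \<in> space M" "\<forall>G\<in>\<G>. x \<notin> G"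
    then have "x \<notin> \<Union>((\<lambda>F. S - F) ` \<F>)" using \<G>(3) by blast
    then show "x \<in> msupport M"
      using \<open>x \<in> space M\<close> S by (auto simp: msupport_def \<F>_def)
  qed
qed

lemma AE_scale_measure: "AE x in M. P x \<Longrightarrow> AE x in scale_measure r M. P x"
  by (auto simp: eventually_ae_filter null_sets_def space_scale_measure)

lemma AE_scale_measure_iff:
  assumes "r \<noteq> 0" shows "(AE x in scale_measure r M. P x) \<longleftrightarrow> (AE x in M. P x)"
  using assms by (auto simp: eventually_ae_filter null_sets_def space_scale_measure)

subsection \<open>Transport plans\<close>

context
  fixes \<mu> :: "'a measure" and \<nu> :: "'b measure"
begin

lemma transport_plansD:
  assumes "P \<in> transport_plans \<mu> \<nu>"
  shows "prob_space P" "sets P = sets (\<mu> \<Otimes>\<^sub>M \<nu>)" "space P = space \<mu> \<times> space \<nu>"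
    "distr P \<mu> fst = \<mu>" "distr P \<nu> snd = \<nu>" "fst \<in> P \<rightarrow>\<^sub>M \<mu>" "snd \<in> P \<rightarrow>\<^sub>M \<nu>"
proof -
  show *: "prob_space P" "sets P = sets (\<mu> \<Otimes>\<^sub>M \<nu>)" "distr P \<mu> fst = \<mu>" "distr P \<nu> snd = \<nu>"
    using assms by (auto simp: transport_plans_def)
  show "space P = space \<mu> \<times> space \<nu>"
    using sets_eq_imp_space_eq[OF *(2)] by (simp add: space_pair_measure)
  show "fst \<in> P \<rightarrow>\<^sub>M \<mu>" "snd \<in> P \<rightarrow>\<^sub>M \<nu>"
    unfolding measurable_cong_sets[OF *(2) refl] by auto
qed

lemma transport_plans_AE_fst:
  assumes "P \<in> transport_plans \<mu> \<nu>" "AE x in \<mu>. R x"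
  shows "AE z in P. R (fst z)"
  using assms(2) transport_plansD(4,6)[OF assms(1)] by (metis AE_distrD)

lemma transport_plans_AE_snd:
  assumes "P \<in> transport_plans \<mu> \<nu>" "AE y in \<nu>. R y"
  shows "AE z in P. R (snd z)"
  using assms(2) transport_plansD(5,7)[OF assms(1)] by (metis AE_distrD)

text \<open>This also descends from the plan to its marginal: a measurable exceptional set has the
  same measure as its preimage under the projection.\<close>

lemma transport_plans_AE_fst_iff:
  assumes "P \<in> transport_plans \<mu> \<nu>" "{x \<in> space \<mu>. R x} \<in> sets \<mu>"
  shows "(AE z in P. R (fst z)) \<longleftrightarrow> (AE x in \<mu>. R x)"
  using AE_distr_iff[OF transport_plansD(6)[OF assms(1)] assms(2)]
  unfolding transport_plansD(4)[OF assms(1)] by (rule sym)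

lemma transport_plans_AE_snd_iff:
  assumes "P \<in> transport_plans \<mu> \<nu>" "{y \<in> space \<nu>. R y} \<in> sets \<nu>"
  shows "(AE z in P. R (snd z)) \<longleftrightarrow> (AE y in \<nu>. R y)"
  using AE_distr_iff[OF transport_plansD(7)[OF assms(1)] assms(2)]
  unfolding transport_plansD(5)[OF assms(1)] by (rule sym)

lemma transport_plans_emeasure_fst:
  assumes "P \<in> transport_plans \<mu> \<nu>" "A \<in> sets \<mu>"
  shows "emeasure P (A \<times> space \<nu>) = emeasure \<mu> A"
proof -
  have "emeasure \<mu> A = emeasure (distr P \<mu> fst) A" using transport_plansD[OF assms(1)] by simp
  also have "\<dots> = emeasure P (fst -` A \<inter> space P)"
    using transport_plansD[OF assms(1)] assms(2) by (intro emeasure_distr) auto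
  also have "fst -` A \<inter> space P = A \<times> space \<nu>"
    using transport_plansD(3)[OF assms(1)] sets.sets_into_space[OF assms(2)] by auto
  finally show ?thesis by simp
qed

lemma transport_plans_emeasure_snd:
  assumes "P \<in> transport_plans \<mu> \<nu>" "B \<in> sets \<nu>"
  shows "emeasure P (space \<mu> \<times> B) = emeasure \<nu> B"
proof -
  have "emeasure \<nu> B = emeasure (distr P \<nu> snd) B" using transport_plansD[OF assms(1)] by simp
  also have "\<dots> = emeasure P (snd -` B \<inter> space P)"
    using transport_plansD[OF assms(1)] assms(2) by (intro emeasure_distr) auto
  also have "snd -` B \<inter> space P = space \<mu> \<times> B"
    using transport_plansD(3)[OF assms(1)] sets.sets_into_space[OF assms(2)] by auto
  finally show ?thesis by simp
qed

lemma transport_plans_times_sets: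
  assumes "P \<in> transport_plans \<mu> \<nu>" "S \<in> sets \<mu>" "T \<in> sets \<nu>"
  shows "S \<times> T \<in> sets P"
  using assms(2,3) transport_plansD(2)[OF assms(1)] by simp

end

section \<open>Comparing the costs of two plans by truncation\<close>

definition truncate :: "nat \<Rightarrow> real \<Rightarrow> real" where
  "truncate n u = max (- real n) (min u (real n))"

lemma truncate_measurable [measurable]: "truncate n \<in> borel_measurable borel"
  unfolding truncate_def by measurable

lemma truncate_tendsto: "(\<lambda>n. truncate n u) \<longlonglongrightarrow> u"
proof (rule tendsto_eventually)
  obtain N where N: "\<bar>u\<bar> \<le> real N" using real_arch_simple by blast
  show "\<forall>\<^sub>F n in sequentially. truncate n u = u"
    using eventually_ge_at_top[of N] by eventually_elim (use N in \<open>auto simp: truncate_def\<close>)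
qed

text \<open>Clipping is odd, nondecreasing and 1-Lipschitz, and the sum is
  \<open>truncate n u - truncate n (- v)\<close>. Monotonicity gives the second claim. The first
  follows from the Lipschitz bound if \<open>- v \<le> u\<close>, and otherwise the sum is at most
  \<open>0\<close>.\<close>

lemma truncate_add_bounds:
  "u + v \<le> w \<Longrightarrow> 0 \<le> w \<Longrightarrow> truncate n u + truncate n v \<le> w"
  "0 \<le> u + v \<Longrightarrow> 0 \<le> truncate n u + truncate n v"
  by (auto simp: truncate_def)

context
  fixes \<mu> :: "'a measure" and \<nu> :: "'b measure" and c :: "'a \<times> 'b \<Rightarrow> real"
  assumes c_nonneg: "\<And>z. c z \<ge> 0" and c_meas: "c \<in> borel_measurable (\<mu> \<Otimes>\<^sub>M \<nu>)"
begin

text \<open>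
  Neither \<open>u\<close> nor \<open>v\<close> need be integrable. Truncating each at height \<open>n\<close> gives an integral that depends
  on the marginals only, and the truncated sums stay below \<open>c\<close> because they lie between \<open>0\<close> and
  \<open>u + v\<close>.
\<close>

lemma integral_split_transfer:
  fixes u :: "'a \<Rightarrow> real" and v :: "'b \<Rightarrow> real"
  assumes P: "P \<in> transport_plans \<mu> \<nu>" and Q: "Q \<in> transport_plans \<mu> \<nu>"
    and u: "u \<in> borel_measurable \<mu>" and v: "v \<in> borel_measurable \<nu>"
    and eq: "AE z in P. u (fst z) + v (snd z) = c z"
    and le: "AE z in Q. u (fst z) + v (snd z) \<le> c z"
    and finP: "(\<integral>\<^sup>+z. ennreal (c z) \<partial>P) < \<infinity>"
  shows "(\<integral>\<^sup>+z. ennreal (c z) \<partial>P) \<le> (\<integral>\<^sup>+z. ennreal (c z) \<partial>Q)"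
    and "(\<integral>\<^sup>+z. ennreal (c z) \<partial>Q) = (\<integral>\<^sup>+z. ennreal (c z) \<partial>P) \<Longrightarrow>
      AE z in Q. u (fst z) + v (snd z) = c z"
proof -
  define w where "w n z = truncate n (u (fst z)) + truncate n (v (snd z))" for n z
  interpret P: prob_space P by (rule transport_plansD[OF P])
  interpret Q: prob_space Q by (rule transport_plansD[OF Q])
  note [measurable] = u v transport_plansD(6,7)[OF P] transport_plansD(6,7)[OF Q]
  have [measurable]: "c \<in> borel_measurable P" "c \<in> borel_measurable Q"
    using c_meas unfolding measurable_cong_sets[OF transport_plansD(2)[OF P] refl]
      measurable_cong_sets[OF transport_plansD(2)[OF Q] refl] by auto
  have bound: "\<bar>truncate n r\<bar> \<le> real n" for n r by (auto simp: truncate_def)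
  \<comment> \<open>For every plan \<open>R\<close> the integral of \<open>w n\<close> splits into
    integrals against the two marginals, so it has the same value under \<open>P\<close> and
    \<open>Q\<close>.\<close>
  have int_u: "integrable R (\<lambda>z. truncate n (u (fst z)))"
    and int_v: "integrable R (\<lambda>z. truncate n (v (snd z)))"
    and split: "(\<integral>z. w n z \<partial>R) = (\<integral>x. truncate n (u x) \<partial>\<mu>) + (\<integral>y. truncate n (v y) \<partial>\<nu>)"
    if R: "R \<in> transport_plans \<mu> \<nu>" for n R
  proof -
    interpret R: prob_space R by (rule transport_plansD[OF R])
    note [measurable] = transport_plansD(6,7)[OF R]
    show *: "integrable R (\<lambda>z. truncate n (u (fst z)))" "integrable R (\<lambda>z. truncate n (v (snd z)))"
      by (auto intro!: R.integrable_const_bound[where B = "real n"] simp: bound)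
    have "(\<integral>x. truncate n (u x) \<partial>\<mu>) = (\<integral>x. truncate n (u x) \<partial>distr R \<mu> fst)"
      "(\<integral>y. truncate n (v y) \<partial>\<nu>) = (\<integral>y. truncate n (v y) \<partial>distr R \<nu> snd)"
      by (simp_all add: transport_plansD[OF R])
    then show "(\<integral>z. w n z \<partial>R) = (\<integral>x. truncate n (u x) \<partial>\<mu>) + (\<integral>y. truncate n (v y) \<partial>\<nu>)"
      unfolding w_def using * by (simp add: integral_distr)
  qed
  have w_meas [measurable]: "w n \<in> borel_measurable P" "w n \<in> borel_measurable Q" for n
    unfolding w_def by measurable
  have w_int: "integrable Q (w n)" for n
    unfolding w_def using int_u[OF Q] int_v[OF Q] by auto
  have w_lim: "(\<lambda>n. w n z) \<longlonglongrightarrow> u (fst z) + v (snd z)" for z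
    unfolding w_def by (intro tendsto_add truncate_tendsto)
  have cP: "integrable P c"
    using finP c_nonneg by (intro integrableI_nonneg) auto
  have "(\<lambda>n. \<integral>z. w n z \<partial>P) \<longlonglongrightarrow> (\<integral>z. c z \<partial>P)"
  proof (rule integral_dominated_convergence[where w = c])
    show "AE z in P. (\<lambda>n. w n z) \<longlonglongrightarrow> c z"
      using eq by eventually_elim (use w_lim in metis)
    show "AE z in P. norm (w n z) \<le> c z" for n
      using eq
    proof eventually_elim
      case (elim z)
      then show ?case
        using truncate_add_bounds[of "u (fst z)" "v (snd z)"] c_nonneg[of z]
        by (simp add: w_def)
    qed
  qed (use cP in auto)
  then have lim: "(\<lambda>n. \<integral>z. w n z \<partial>Q) \<longlonglongrightarrow> (\<integral>z. c z \<partial>P)"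
    by (simp add: split[OF P] split[OF Q])
  have w_le: "AE z in Q. w n z \<le> c z" for n
    using le by eventually_elim
      (use truncate_add_bounds(1) c_nonneg in \<open>auto simp: w_def\<close>)
  have nnP: "(\<integral>\<^sup>+z. ennreal (c z) \<partial>P) = ennreal (\<integral>z. c z \<partial>P)"
    using cP c_nonneg by (intro nn_integral_eq_integral) auto
  have cQ: "integrable Q c" if "(\<integral>\<^sup>+z. ennreal (c z) \<partial>Q) < \<infinity>"
    using that c_nonneg by (intro integrableI_nonneg) auto
  have nnQ: "(\<integral>\<^sup>+z. ennreal (c z) \<partial>Q) = ennreal (\<integral>z. c z \<partial>Q)" if "(\<integral>\<^sup>+z. ennreal (c z) \<partial>Q) < \<infinity>"
    using cQ[OF that] c_nonneg by (intro nn_integral_eq_integral) auto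
  show "(\<integral>\<^sup>+z. ennreal (c z) \<partial>P) \<le> (\<integral>\<^sup>+z. ennreal (c z) \<partial>Q)"
  proof (cases "(\<integral>\<^sup>+z. ennreal (c z) \<partial>Q) < \<infinity>")
    case True
    have "(\<integral>z. c z \<partial>P) \<le> (\<integral>z. c z \<partial>Q)"
      using lim by (rule LIMSEQ_le_const2)
        (use w_le w_int cQ[OF True] in \<open>auto intro!: integral_mono_AE\<close>)
    then show ?thesis using nnP nnQ[OF True] by (simp add: ennreal_leI)
  qed (simp add: less_top[symmetric])
  assume QP: "(\<integral>\<^sup>+z. ennreal (c z) \<partial>Q) = (\<integral>\<^sup>+z. ennreal (c z) \<partial>P)"
  then have finQ: "(\<integral>\<^sup>+z. ennreal (c z) \<partial>Q) < \<infinity>" using finP by simp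
  have "ennreal (\<integral>z. c z \<partial>Q) = ennreal (\<integral>z. c z \<partial>P)"
    using QP nnP nnQ[OF finQ] by simp
  then have QP': "(\<integral>z. c z \<partial>Q) = (\<integral>z. c z \<partial>P)"
    using c_nonneg by (simp add: integral_nonneg)
  \<comment> \<open>Under \<open>Q\<close> the sum \<open>u + v\<close> is only bounded above, so
    dominated convergence is replaced by Fatou's lemma for the slack \<open>c - w n\<close>. The
    integrals of this slack tend to \<open>0\<close> by \<open>lim\<close> and the equality of the
    costs.\<close>
  have "(\<integral>\<^sup>+z. ennreal (c z - (u (fst z) + v (snd z))) \<partial>Q) =
      (\<integral>\<^sup>+z. liminf (\<lambda>n. ennreal (c z - w n z)) \<partial>Q)"
    by (intro nn_integral_cong lim_imp_Liminf[symmetric] tendsto_ennrealI tendsto_diff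
        tendsto_const w_lim) simp
  also have "\<dots> \<le> liminf (\<lambda>n. \<integral>\<^sup>+z. ennreal (c z - w n z) \<partial>Q)"
    by (intro nn_integral_liminf) measurable
  also have "\<dots> = liminf (\<lambda>n. ennreal ((\<integral>z. c z \<partial>Q) - (\<integral>z. w n z \<partial>Q)))"
  proof -
    have "(\<integral>\<^sup>+z. ennreal (c z - w n z) \<partial>Q) = ennreal ((\<integral>z. c z \<partial>Q) - (\<integral>z. w n z \<partial>Q))" for n
      using w_le[of n] w_int[of n] cQ[OF finQ]
      by (subst nn_integral_eq_integral) auto
    then show ?thesis by simp
  qed
  also have "\<dots> = ennreal 0"
    using QP' by (intro lim_imp_Liminf tendsto_ennrealI)
      (auto intro!: tendsto_eq_intros lim)
  finally have "AE z in Q. ennreal (c z - (u (fst z) + v (snd z))) = 0"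
    by (subst (asm) ennreal_0) (simp add: nn_integral_0_iff_AE)
  with le show "AE z in Q. u (fst z) + v (snd z) = c z"
    by eventually_elim (auto simp: ennreal_eq_0_iff)
qed

end

subsection \<open>Potentials and tight plans\<close>

text \<open>The index set may be uncountable: strict sublevel sets of the infimum are unions of open
  sets, hence open.\<close>

lemma borel_measurable_INF_continuous:
  fixes F :: "'i \<Rightarrow> 'a::topological_space \<Rightarrow> ereal"
  assumes "\<And>i. i \<in> I \<Longrightarrow> continuous_on UNIV (F i)"
  shows "(\<lambda>x. INF i\<in>I. F i x) \<in> borel_measurable borel"
proof (rule borel_measurableI_less)
  fix a :: ereal
  have "{x \<in> space borel. (INF i\<in>I. F i x) < a} = (\<Union>i\<in>I. {x. F i x < a})"
    by (auto simp: INF_less_iff)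
  also have "open \<dots>"
    using assms by (intro open_UN ballI open_Collect_less) auto
  finally show "{x \<in> space borel. (INF i\<in>I. F i x) < a} \<in> sets borel"
    by simp
qed

lemma continuous_on_ereal_diff_const:
  assumes "continuous_on S h" "a \<noteq> \<infinity>"
  shows "continuous_on S (\<lambda>x. ereal (h x) - a)"
  using assms by (cases a) (auto intro!: continuous_intros)

text \<open>This makes every potential Borel measurable, although \<open>c_concave\<close> only says
  that it is the transform of some function \<open>g\<close>.\<close>

lemma ctransform_fst_measurable:
  assumes "continuous_on UNIV c" "\<And>y. y \<in> B \<Longrightarrow> g y \<noteq> \<infinity>"
  shows "ctransform_fst c B g \<in> borel_measurable borel"
proof -
  have "continuous_on UNIV (\<lambda>x. c (x, y))" for y
    by (rule continuous_on_compose2[OF assms(1)]) (auto intro!: continuous_intros)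
  then show ?thesis
    unfolding ctransform_fst_def using assms(2)
    by (intro borel_measurable_INF_continuous continuous_on_ereal_diff_const) auto
qed

lemma ctransform_snd_measurable:
  assumes "continuous_on UNIV c" "\<And>x. x \<in> A \<Longrightarrow> f x \<noteq> \<infinity>"
  shows "ctransform_snd c A f \<in> borel_measurable borel"
proof -
  have "continuous_on UNIV (\<lambda>y. c (x, y))" for x
    by (rule continuous_on_compose2[OF assms(1)]) (auto intro!: continuous_intros)
  then show ?thesis
    unfolding ctransform_snd_def using assms(2)
    by (intro borel_measurable_INF_continuous continuous_on_ereal_diff_const) auto
qed

text \<open>A point at which \<open>f\<close> is finite bounds the infimum. Thus sums of
  \<open>f\<close> and its transform never have the form \<infinity> - \<infinity>.\<close>

lemma ctransform_snd_not_PInf: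
  assumes "c_concave c A B f"
  shows "ctransform_snd c A f y \<noteq> \<infinity>"
proof -
  obtain x where x: "x \<in> A" "f x \<noteq> -\<infinity>" "f x \<noteq> \<infinity>"
    using assms by (auto simp: c_concave_def)
  have "ctransform_snd c A f y \<le> ereal (c (x, y)) - f x"
    unfolding ctransform_snd_def using x(1) by (rule INF_lower)
  then show ?thesis using x by (cases "f x") auto
qed

text \<open>The Fenchel-Young type inequality of the duality, read off from one member of the
  infimum.\<close>

lemma c_concave_add_le:
  assumes "c_concave c A B f" "x \<in> A"
  shows "f x + ctransform_snd c A f y \<le> ereal (c (x, y))"
proof -
  have "f x \<noteq> \<infinity>" using assms by (auto simp: c_concave_def)
  moreover have "ctransform_snd c A f y \<le> ereal (c (x, y)) - f x"
    unfolding ctransform_snd_def using assms(2) by (rule INF_lower)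
  ultimately show ?thesis
    using ctransform_snd_not_PInf[OF assms(1), of y]
    by (cases "f x"; cases "ctransform_snd c A f y") auto
qed

text \<open>Complementary slackness, the equality case of \<open>c_concave_add_le\<close>. As a
  pointwise condition it passes to restrictions more easily than the integral identity of
  \<open>kantorovich_potentials\<close>; the two are translated into each other by
  \<open>tight_imp_kantorovich_potential\<close> and
  \<open>kantorovich_potential_tight\<close>.\<close>

definition tight ::
  "('a \<times> 'b \<Rightarrow> real) \<Rightarrow> 'a set \<Rightarrow> ('a \<Rightarrow> ereal) \<Rightarrow> ('a \<times> 'b) measure \<Rightarrow> bool" where
  "tight c A f P \<longleftrightarrow> (AE z in P. f (fst z) + ctransform_snd c A f (snd z) = ereal (c z))"

context
  fixes \<mu> :: "'a measure" and \<nu> :: "'b measure" and c :: "'a \<times> 'b \<Rightarrow> real" and f :: "'a \<Rightarrow> ereal"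
  assumes c_nonneg: "\<And>z. c z \<ge> 0" and c_meas: "c \<in> borel_measurable (\<mu> \<Otimes>\<^sub>M \<nu>)"
    and conc: "c_concave c (space \<mu>) (space \<nu>) f"
    and f_meas: "f \<in> borel_measurable \<mu>"
    and fc_meas: "ctransform_snd c (space \<mu>) f \<in> borel_measurable \<nu>"
begin

text \<open>A sum equal to a real cost has real summands. Since the conclusion concerns the
  marginals only, it carries over to every other plan.\<close>

lemma tight_AE_real:
  assumes P: "P \<in> transport_plans \<mu> \<nu>" and "tight c (space \<mu>) f P"
  shows "AE x in \<mu>. \<bar>f x\<bar> \<noteq> \<infinity>" "AE y in \<nu>. \<bar>ctransform_snd c (space \<mu>) f y\<bar> \<noteq> \<infinity>"
proof -
  note [measurable] = f_meas fc_meas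
  have *: "AE z in P. \<bar>f (fst z)\<bar> \<noteq> \<infinity> \<and> \<bar>ctransform_snd c (space \<mu>) f (snd z)\<bar> \<noteq> \<infinity>"
    using assms(2) unfolding tight_def
  proof eventually_elim
    case (elim z)
    then show ?case
      by (cases "f (fst z)"; cases "ctransform_snd c (space \<mu>) f (snd z)") auto
  qed
  show "AE x in \<mu>. \<bar>f x\<bar> \<noteq> \<infinity>"
    using * by (subst transport_plans_AE_fst_iff[OF P, symmetric]) auto
  show "AE y in \<nu>. \<bar>ctransform_snd c (space \<mu>) f y\<bar> \<noteq> \<infinity>"
    using * by (subst transport_plans_AE_snd_iff[OF P, symmetric]) auto
qed

text \<open>Duality with potentials that need not be integrable separately, by reduction to
  \<open>integral_split_transfer\<close>. The second claim lets a potential witnessed by one optimal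
  plan be used with any other.\<close>

lemma tight_transfer:
  assumes P: "P \<in> transport_plans \<mu> \<nu>" "tight c (space \<mu>) f P" "(\<integral>\<^sup>+z. ennreal (c z) \<partial>P) < \<infinity>"
    and Q: "Q \<in> transport_plans \<mu> \<nu>"
  shows "(\<integral>\<^sup>+z. ennreal (c z) \<partial>P) \<le> (\<integral>\<^sup>+z. ennreal (c z) \<partial>Q)"
    and "(\<integral>\<^sup>+z. ennreal (c z) \<partial>Q) = (\<integral>\<^sup>+z. ennreal (c z) \<partial>P) \<Longrightarrow> tight c (space \<mu>) f Q"
proof -
  let ?fc = "ctransform_snd c (space \<mu>) f"
  \<comment> \<open>Infinite values are replaced by \<open>0\<close>; by
    \<open>tight_AE_real\<close> this changes nothing outside a null set, for any plan.\<close>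
  define u where "u x = real_of_ereal (f x)" for x
  define v where "v y = real_of_ereal (?fc y)" for y
  have uv: "u \<in> borel_measurable \<mu>" "v \<in> borel_measurable \<nu>"
    unfolding u_def v_def using f_meas fc_meas by auto
  have real: "AE z in R. f (fst z) = ereal (u (fst z)) \<and> ?fc (snd z) = ereal (v (snd z))"
    if "R \<in> transport_plans \<mu> \<nu>" for R
    using transport_plans_AE_fst[OF that tight_AE_real(1)[OF P(1,2)]]
      transport_plans_AE_snd[OF that tight_AE_real(2)[OF P(1,2)]]
    by eventually_elim (auto simp: u_def v_def ereal_real)
  have eq: "AE z in P. u (fst z) + v (snd z) = c z"
    using real[OF P(1)] P(2)[unfolded tight_def] by eventually_elim auto
  have le: "AE z in Q. u (fst z) + v (snd z) \<le> c z"
    using real[OF Q] AE_space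
  proof eventually_elim
    case (elim z)
    have "f (fst z) + ?fc (snd z) \<le> ereal (c (fst z, snd z))"
      using elim(2) transport_plansD(3)[OF Q] by (intro c_concave_add_le[OF conc]) auto
    then show ?case using elim(1) by simp
  qed
  note transfer = integral_split_transfer[OF c_nonneg c_meas P(1) Q uv eq le P(3)]
  show "(\<integral>\<^sup>+z. ennreal (c z) \<partial>P) \<le> (\<integral>\<^sup>+z. ennreal (c z) \<partial>Q)" by (rule transfer)
  assume "(\<integral>\<^sup>+z. ennreal (c z) \<partial>Q) = (\<integral>\<^sup>+z. ennreal (c z) \<partial>P)"
  from transfer(2)[OF this] real[OF Q] show "tight c (space \<mu>) f Q"
    unfolding tight_def by eventually_elim auto
qed

lemma tight_imp_optimal:
  assumes P: "P \<in> transport_plans \<mu> \<nu>" "tight c (space \<mu>) f P" "(\<integral>\<^sup>+z. ennreal (c z) \<partial>P) < \<infinity>"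
  shows "optimal_plan c \<mu> \<nu> P"
  unfolding optimal_plan_def transport_cost_def
  using tight_transfer(1)[OF P] P(1) by (auto intro!: antisym INF_greatest INF_lower)

text \<open>The plan \<open>P\<close> itself is the optimal witness. As \<open>c\<close> is
  nonnegative, tightness makes the negative part of the integrand vanish almost surely, and the
  positive part integrates to the cost.\<close>

lemma tight_imp_kantorovich_potential:
  assumes P: "P \<in> transport_plans \<mu> \<nu>" "tight c (space \<mu>) f P" "(\<integral>\<^sup>+z. ennreal (c z) \<partial>P) < \<infinity>"
  shows "f \<in> kantorovich_potentials c \<mu> \<nu>"
proof -
  let ?h = "\<lambda>z. f (fst z) + ctransform_snd c (space \<mu>) f (snd z)"
  have "(\<integral>\<^sup>+z. e2ennreal (?h z) \<partial>P) = (\<integral>\<^sup>+z. ennreal (c z) \<partial>P)"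
  proof (rule nn_integral_cong_AE)
    show "AE z in P. e2ennreal (?h z) = ennreal (c z)"
      using P(2)[unfolded tight_def] by eventually_elim simp
  qed
  moreover have "(\<integral>\<^sup>+z. e2ennreal (- ?h z) \<partial>P) = (\<integral>\<^sup>+z. 0 \<partial>P)"
  proof (rule nn_integral_cong_AE)
    show "AE z in P. e2ennreal (- ?h z) = 0"
      using P(2)[unfolded tight_def] by eventually_elim (simp add: c_nonneg ennreal_neg)
  qed
  ultimately have "ereal_integral P ?h = enn2ereal (transport_cost c \<mu> \<nu>)"
    using tight_imp_optimal[OF P] by (simp add: ereal_integral_def optimal_plan_def zero_ennreal.rep_eq)
  then show ?thesis
    using tight_imp_optimal[OF P] conc
    by (auto simp: kantorovich_potentials_def case_prod_unfold)
qed

text \<open>The integrand lies below \<open>c\<close> and has the same finite integral, so the two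
  agree almost surely under the witnessing plan \<open>P\<close>. Then \<open>tight_transfer\<close>
  moves this to \<open>Q\<close>.\<close>

lemma kantorovich_potential_tight:
  assumes f: "f \<in> kantorovich_potentials c \<mu> \<nu>" and fin: "transport_cost c \<mu> \<nu> < \<infinity>"
    and Q: "optimal_plan c \<mu> \<nu> Q"
  shows "tight c (space \<mu>) f Q"
proof -
  let ?h = "\<lambda>z. f (fst z) + ctransform_snd c (space \<mu>) f (snd z)"
  obtain P where P: "optimal_plan c \<mu> \<nu> P"
    and eq: "enn2ereal (transport_cost c \<mu> \<nu>) = ereal_integral P ?h"
    using f by (auto simp: kantorovich_potentials_def case_prod_unfold)
  from P have P': "P \<in> transport_plans \<mu> \<nu>" "(\<integral>\<^sup>+z. ennreal (c z) \<partial>P) = transport_cost c \<mu> \<nu>"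
    by (auto simp: optimal_plan_def)
  note [measurable] = f_meas fc_meas transport_plansD(6,7)[OF P'(1)]
  have [measurable]: "c \<in> borel_measurable P"
    using c_meas unfolding measurable_cong_sets[OF transport_plansD(2)[OF P'(1)] refl] .
  have le: "?h z \<le> ereal (c z)" if "z \<in> space P" for z
    using c_concave_add_le[OF conc, of "fst z" "snd z"] that transport_plansD(3)[OF P'(1)] by auto
  have le': "e2ennreal (?h z) \<le> ennreal (c z)" if "z \<in> space P" for z
    using e2ennreal_mono[OF le[OF that]] by simp
  have "(\<integral>\<^sup>+z. e2ennreal (?h z) \<partial>P) \<le> transport_cost c \<mu> \<nu>"
    unfolding P'(2)[symmetric] using le' by (intro nn_integral_mono) auto
  moreover have "enn2ereal (transport_cost c \<mu> \<nu>) =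
      enn2ereal (\<integral>\<^sup>+z. e2ennreal (?h z) \<partial>P) - enn2ereal (\<integral>\<^sup>+z. e2ennreal (- ?h z) \<partial>P)"
    using eq by (simp add: ereal_integral_def)
  \<comment> \<open>The positive part contributes at most the finite cost, and the difference of the
    two parts equals the cost. Hence nothing is subtracted.\<close>
  ultimately have pos: "(\<integral>\<^sup>+z. e2ennreal (?h z) \<partial>P) = transport_cost c \<mu> \<nu>"
    and neg: "(\<integral>\<^sup>+z. e2ennreal (- ?h z) \<partial>P) = 0"
    using fin
    by (cases "transport_cost c \<mu> \<nu>"; cases "\<integral>\<^sup>+z. e2ennreal (?h z) \<partial>P";
        cases "\<integral>\<^sup>+z. e2ennreal (- ?h z) \<partial>P"; simp add: enn2ereal_ennreal top_ennreal.rep_eq)+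
  have "(\<integral>\<^sup>+z. ennreal (c z) - e2ennreal (?h z) \<partial>P) =
      (\<integral>\<^sup>+z. ennreal (c z) \<partial>P) - (\<integral>\<^sup>+z. e2ennreal (?h z) \<partial>P)"
    using pos fin le' by (intro nn_integral_diff) auto
  also have "\<dots> = 0" using pos P'(2) fin by simp
  finally have "AE z in P. ennreal (c z) - e2ennreal (?h z) = 0"
    by (subst (asm) nn_integral_0_iff_AE) auto
  moreover have "AE z in P. e2ennreal (- ?h z) = 0"
    using neg by (subst (asm) nn_integral_0_iff_AE) auto
  ultimately have "tight c (space \<mu>) f P"
    unfolding tight_def using AE_space
  proof eventually_elim
    case (elim z)
    \<comment> \<open>Since \<open>e2ennreal\<close> sends negative values to \<open>0\<close>, the
      sign of \<open>?h z\<close> has to be settled before the comparison with \<open>c z\<close>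
      can be lifted back to extended reals.\<close>
    have "- ?h z \<le> 0"
      using elim(2) by (metis enn2ereal_e2ennreal linorder_le_cases order_refl zero_ennreal.rep_eq)
    then have "?h z \<ge> 0" by (metis ereal_uminus_le_0_iff)
    moreover have "ennreal (c z) \<le> e2ennreal (?h z)"
      using elim(1) by (simp add: diff_eq_0_iff_ennreal)
    ultimately have "ereal (c z) \<le> ?h z"
      using c_nonneg[of z]
      by (metis enn2ereal_e2ennreal enn2ereal_ennreal less_eq_ennreal.rep_eq)
    then show ?case using le[OF elim(3)] by auto
  qed
  then show ?thesis
    using tight_transfer(2)[OF P'(1), of Q] Q P'(2) fin by (auto simp: optimal_plan_def)
qed

end

subsection \<open>Restricted problems\<close>

text \<open>Membership in \<open>transport_plans\<close> demands the exact product \<sigma>-algebra.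
  One inclusion is checked on rectangles, the other by pulling back along the inclusion map.\<close>

lemma sets_pair_restrict_space:
  assumes "A \<in> sets M"
  shows "sets (restrict_space M A \<Otimes>\<^sub>M N) = sets (restrict_space (M \<Otimes>\<^sub>M N) (A \<times> space N))"
proof (intro equalityI subsetI)
  have AN: "A \<times> space N \<in> sets (M \<Otimes>\<^sub>M N)" using assms by simp
  have AM: "A \<subseteq> space M" using sets.sets_into_space[OF assms] .
  fix X
  {
    assume "X \<in> sets (restrict_space M A \<Otimes>\<^sub>M N)"
    moreover have "sets (restrict_space M A \<Otimes>\<^sub>M N) \<subseteq> sets (restrict_space (M \<Otimes>\<^sub>M N) (A \<times> space N))"
    proof (rule sets_pair_in_sets)
      fix a b assume "a \<in> sets (restrict_space M A)" "b \<in> sets N"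
      then show "a \<times> b \<in> sets (restrict_space (M \<Otimes>\<^sub>M N) (A \<times> space N))"
        using assms AN sets.sets_into_space[of b N] by (auto simp: sets_restrict_space_iff)
    qed
    ultimately show "X \<in> sets (restrict_space (M \<Otimes>\<^sub>M N) (A \<times> space N))" by blast
  next
    assume "X \<in> sets (restrict_space (M \<Otimes>\<^sub>M N) (A \<times> space N))"
    then have X: "X \<in> sets (M \<Otimes>\<^sub>M N)" "X \<subseteq> A \<times> space N"
      using AN by (auto simp: sets_restrict_space_iff)
    have "(\<lambda>x. x) \<in> restrict_space M A \<rightarrow>\<^sub>M M"
      by (rule measurable_restrict_space1) simp
    then have "fst \<in> restrict_space M A \<Otimes>\<^sub>M N \<rightarrow>\<^sub>M M"
      by (rule measurable_compose[OF measurable_fst])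
    then have "(\<lambda>z. (fst z, snd z)) \<in> restrict_space M A \<Otimes>\<^sub>M N \<rightarrow>\<^sub>M M \<Otimes>\<^sub>M N"
      by measurable
    from measurable_sets[OF this X(1)] show "X \<in> sets (restrict_space M A \<Otimes>\<^sub>M N)"
      using X(2) AM by (simp add: space_pair_measure space_restrict_space Int_absorb2 Int_absorb1)
  }
qed

text \<open>The conditional law of \<open>\<pi>\<close> given that the first coordinate lies in
  \<open>A\<close>; it couples the marginals of the restricted problem.\<close>

definition restricted_plan ::
  "'a measure \<Rightarrow> 'b measure \<Rightarrow> ('a \<times> 'b) measure \<Rightarrow> 'a set \<Rightarrow> ('a \<times> 'b) measure" where
  "restricted_plan \<mu> \<nu> \<pi> A =
     scale_measure (inverse (emeasure \<mu> A)) (restrict_space \<pi> (A \<times> space \<nu>))"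

lemma sets_restricted [simp]:
  "sets (restricted_fst \<mu> A) = sets (restrict_space \<mu> A)"
  "sets (restricted_snd \<mu> \<nu> \<pi> A) = sets \<nu>"
  by (simp_all add: restricted_fst_def restricted_snd_def)

lemma space_restricted:
  "space (restricted_fst \<mu> A) = A \<inter> space \<mu>"
  "space (restricted_snd \<mu> \<nu> \<pi> A) = space \<nu>"
  by (simp_all add: restricted_fst_def restricted_snd_def space_scale_measure space_restrict_space)

context
  fixes \<mu> :: "'a measure" and \<nu> :: "'b measure" and \<pi> :: "('a \<times> 'b) measure" and A :: "'a set"
  assumes \<pi>: "\<pi> \<in> transport_plans \<mu> \<nu>" and A: "A \<in> sets \<mu>" "emeasure \<mu> A \<noteq> 0" "emeasure \<mu> A \<noteq> \<infinity>"
begin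

lemma restricted_sets: "A \<times> space \<nu> \<inter> space \<pi> \<in> sets \<pi>"
  using A(1) transport_plansD(2)[OF \<pi>] by (intro sets.Int) auto

lemma restricted_plan_AE:
  assumes "AE z in \<pi>. fst z \<in> A \<longrightarrow> P z"
  shows "AE z in restricted_plan \<mu> \<nu> \<pi> A. P z"
  unfolding restricted_plan_def
proof (rule AE_scale_measure, subst AE_restrict_space_iff[OF restricted_sets])
  show "AE z in \<pi>. z \<in> A \<times> space \<nu> \<longrightarrow> P z" using assms by eventually_elim auto
qed

lemma restricted_fst_AE:
  assumes "AE x in restricted_fst \<mu> A. P x"
  shows "AE x in \<mu>. x \<in> A \<longrightarrow> P x"
proof -
  have "inverse (emeasure \<mu> A) \<noteq> 0" using A(3) by simp
  from assms[unfolded restricted_fst_def AE_scale_measure_iff[OF this]]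
  show ?thesis using A(1) by (subst (asm) AE_restrict_space_iff) auto
qed

lemma restricted_plan_nn_integral_finite:
  assumes "h \<in> borel_measurable \<pi>" "(\<integral>\<^sup>+z. h z \<partial>\<pi>) < \<infinity>"
  shows "(\<integral>\<^sup>+z. h z \<partial>restricted_plan \<mu> \<nu> \<pi> A) < \<infinity>"
proof -
  have "(\<integral>\<^sup>+z. h z \<partial>restricted_plan \<mu> \<nu> \<pi> A) =
      inverse (emeasure \<mu> A) * (\<integral>\<^sup>+z. h z \<partial>restrict_space \<pi> (A \<times> space \<nu>))"
    unfolding restricted_plan_def
    using assms(1) by (intro nn_integral_scale_measure measurable_restrict_space1)
  also have "(\<integral>\<^sup>+z. h z \<partial>restrict_space \<pi> (A \<times> space \<nu>)) \<le> (\<integral>\<^sup>+z. h z \<partial>\<pi>)"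
    by (subst nn_integral_restrict_space[OF restricted_sets])
      (auto intro!: nn_integral_mono split: split_indicator)
  finally show ?thesis
    using assms(2) A
    by (auto simp: ennreal_mult_less_top less_top[symmetric] mult_left_mono
        ennreal_mult_eq_top_iff top_unique)
qed

lemma restricted_plan_transport_plans:
  "restricted_plan \<mu> \<nu> \<pi> A \<in> transport_plans (restricted_fst \<mu> A) (restricted_snd \<mu> \<nu> \<pi> A)"
  (is "?\<rho> \<in> transport_plans ?\<mu> ?\<nu>")
proof -
  note \<pi>D = transport_plansD[OF \<pi>]
  have AM: "A \<subseteq> space \<mu>" using sets.sets_into_space[OF A(1)] .
  have sets: "sets ?\<rho> = sets (?\<mu> \<Otimes>\<^sub>M ?\<nu>)"
  proof -
    have "sets (?\<mu> \<Otimes>\<^sub>M ?\<nu>) = sets (restrict_space \<mu> A \<Otimes>\<^sub>M \<nu>)"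
      by (intro sets_pair_measure_cong) auto
    also have "\<dots> = sets (restrict_space (\<mu> \<Otimes>\<^sub>M \<nu>) (A \<times> space \<nu>))"
      using A(1) by (rule sets_pair_restrict_space)
    also have "\<dots> = sets (restrict_space \<pi> (A \<times> space \<nu>))"
      using \<pi>D(2) by (intro sets_restrict_space_cong) auto
    finally show ?thesis by (simp add: restricted_plan_def)
  qed
  have space: "space ?\<rho> = A \<times> space \<nu>"
    using sets_eq_imp_space_eq[OF sets] AM by (auto simp: space_pair_measure space_restricted)
  have emeasure: "emeasure ?\<rho> X = inverse (emeasure \<mu> A) * emeasure \<pi> X" if "X \<subseteq> A \<times> space \<nu>" for X
    using that restricted_sets by (simp add: restricted_plan_def emeasure_restrict_space)
  have fst: "fst \<in> ?\<rho> \<rightarrow>\<^sub>M ?\<mu>" and snd: "snd \<in> ?\<rho> \<rightarrow>\<^sub>M ?\<nu>"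
    unfolding measurable_cong_sets[OF sets refl] by auto
  have "prob_space ?\<rho>"
  proof
    show "emeasure ?\<rho> (space ?\<rho>) = 1"
      unfolding space using transport_plans_emeasure_fst[OF \<pi> A(1)] A
      by (subst emeasure) (auto simp: mult.commute divide_ennreal_def[symmetric] ennreal_divide_self
        less_top[symmetric])
  qed
  moreover have "distr ?\<rho> ?\<mu> fst = ?\<mu>"
  proof (rule measure_eqI)
    fix B assume "B \<in> sets (distr ?\<rho> ?\<mu> fst)"
    then have B: "B \<in> sets ?\<mu>" "B \<in> sets \<mu>" "B \<subseteq> A"
      using A(1) AM by (auto simp: sets_restrict_space_iff Int_absorb2)
    have "emeasure (distr ?\<rho> ?\<mu> fst) B = emeasure ?\<rho> (B \<times> space \<nu>)"
      using B by (subst emeasure_distr[OF fst])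
        (auto simp: space intro!: arg_cong[where f = "emeasure ?\<rho>"])
    also have "\<dots> = inverse (emeasure \<mu> A) * emeasure \<mu> B"
      using B transport_plans_emeasure_fst[OF \<pi> B(2)] by (subst emeasure) auto
    also have "\<dots> = emeasure ?\<mu> B"
      using B A(1) AM by (simp add: restricted_fst_def emeasure_restrict_space Int_absorb2)
    finally show "emeasure (distr ?\<rho> ?\<mu> fst) B = emeasure ?\<mu> B" .
  qed simp
  moreover have "distr ?\<rho> ?\<nu> snd = ?\<nu>"
  proof (rule measure_eqI)
    fix B assume "B \<in> sets (distr ?\<rho> ?\<nu> snd)"
    then have B: "B \<in> sets ?\<nu>" "B \<in> sets \<nu>" "B \<subseteq> space \<nu>"
      using sets.sets_into_space[of B \<nu>] by auto
    have "emeasure (distr ?\<rho> ?\<nu> snd) B = emeasure ?\<rho> (A \<times> B)"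
      using B by (subst emeasure_distr[OF snd])
        (auto simp: space intro!: arg_cong[where f = "emeasure ?\<rho>"])
    also have "\<dots> = inverse (emeasure \<mu> A) * emeasure \<pi> (A \<times> B)"
      using B by (subst emeasure) auto
    also have "\<dots> = emeasure ?\<nu> B"
      using emeasure_restricted_snd[OF \<pi> A(1) B(2)] by (simp add: divide_ennreal_def mult.commute)
    finally show "emeasure (distr ?\<rho> ?\<nu> snd) B = emeasure ?\<nu> B" .
  qed simp
  ultimately show ?thesis using sets by (auto simp: transport_plans_def)
qed

end

text \<open>The second space does not change, so the same \<open>g\<close> represents
  \<open>f\<close> on \<open>A\<close>. Tightness survives under the restricted plan, which
  certifies both the optimality of that plan and the potential.\<close>

lemma restricted_kantorovich_potential:
  fixes \<mu> :: "'a::polish_space measure" and \<nu> :: "'b::polish_space measure"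
  assumes "prob_space \<mu>" and \<mu>: "sets \<mu> = sets borel" and \<nu>: "sets \<nu> = sets borel"
    and c: "continuous_on UNIV c" "\<And>z. c z \<ge> 0" and fin: "transport_cost c \<mu> \<nu> < \<infinity>"
    and opt: "optimal_plan c \<mu> \<nu> \<pi>" and A: "A \<in> sets \<mu>" "emeasure \<mu> A > 0"
    and conc: "c_concave c UNIV UNIV f" and f: "f \<in> borel_measurable borel"
    and tight: "tight c UNIV f \<pi>"
  shows "f \<in> kantorovich_potentials c (restricted_fst \<mu> A) (restricted_snd \<mu> \<nu> \<pi> A)"
    (is "f \<in> kantorovich_potentials c ?\<mu> ?\<nu>")
proof -
  interpret \<mu>: prob_space \<mu> by fact
  have sp: "space \<mu> = UNIV" "space \<nu> = UNIV"
    using sets_eq_imp_space_eq[OF \<mu>] sets_eq_imp_space_eq[OF \<nu>] by auto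
  have \<pi>: "\<pi> \<in> transport_plans \<mu> \<nu>" using opt by (simp add: optimal_plan_def)
  have A': "emeasure \<mu> A \<noteq> 0" "emeasure \<mu> A \<noteq> \<infinity>" using A(2) by auto
  note \<rho> = restricted_plan_transport_plans[OF \<pi> A(1) A']
  let ?\<rho> = "restricted_plan \<mu> \<nu> \<pi> A"
  have space: "space ?\<mu> = A" "space ?\<nu> = UNIV" by (auto simp: space_restricted sp)
  have c_borel: "c \<in> borel_measurable (borel \<Otimes>\<^sub>M borel)"
    using c(1) by (simp add: borel_prod borel_measurable_continuous_onI)
  have c_meas: "c \<in> borel_measurable (\<mu> \<Otimes>\<^sub>M \<nu>)"
    using c_borel unfolding measurable_cong_sets[OF sets_pair_measure_cong[OF \<mu> \<nu>] refl] .
  have c_meas_\<pi>: "c \<in> borel_measurable \<pi>"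
    using c_meas unfolding measurable_cong_sets[OF transport_plansD(2)[OF \<pi>] refl] .
  have c_meas': "c \<in> borel_measurable (?\<mu> \<Otimes>\<^sub>M ?\<nu>)"
  proof -
    have "c \<in> borel_measurable ?\<rho>"
      unfolding restricted_plan_def
      using measurable_restrict_space1[OF c_meas_\<pi>]
      by (simp add: measurable_cong_sets[OF sets_scale_measure refl])
    then show ?thesis
      unfolding measurable_cong_sets[OF transport_plansD(2)[OF \<rho>] refl] .
  qed
  have fmu: "f \<in> borel_measurable \<mu>" using f unfolding measurable_cong_sets[OF \<mu> refl] .
  have "f \<in> borel_measurable (restrict_space \<mu> A)" using fmu by (rule measurable_restrict_space1)
  then have f': "f \<in> borel_measurable ?\<mu>"
    unfolding measurable_cong_sets[OF sets_restricted(1) refl] .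
  have f_not_PInf: "f x \<noteq> \<infinity>" for x using conc by (auto simp: c_concave_def)
  have fc_meas: "ctransform_snd c S f \<in> borel_measurable \<nu>" for S
    using ctransform_snd_measurable[OF c(1)] f_not_PInf unfolding measurable_cong_sets[OF \<nu> refl] by auto
  have fc': "ctransform_snd c (space ?\<mu>) f \<in> borel_measurable ?\<nu>"
    unfolding measurable_cong_sets[OF sets_restricted(2) refl] by (rule fc_meas)
  \<comment> \<open>Tightness makes \<open>f\<close> finite almost everywhere, so it cannot be
    infinite on all of a set of positive measure.\<close>
  have "\<exists>x\<in>A. f x \<noteq> -\<infinity>"
  proof (rule ccontr)
    assume "\<not> (\<exists>x\<in>A. f x \<noteq> -\<infinity>)"
    moreover have "AE x in \<mu>. \<bar>f x\<bar> \<noteq> \<infinity>"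
      using tight_AE_real(1)[where c = c and f = f and P = \<pi> and \<mu> = \<mu> and \<nu> = \<nu>]
        c(2) c_meas conc fmu fc_meas \<pi> tight sp by auto
    ultimately have "AE x in \<mu>. x \<notin> A" by (auto elim!: eventually_mono)
    then have "A \<in> null_sets \<mu>" using A(1) by (simp add: AE_iff_null_sets)
    then show False using A'(1) by auto
  qed
  then have conc': "c_concave c (space ?\<mu>) (space ?\<nu>) f"
    using conc unfolding space by (auto simp: c_concave_def)
  have "tight c (space ?\<mu>) f ?\<rho>"
    unfolding tight_def space
  proof (rule restricted_plan_AE[OF \<pi> A(1) A'])
    show "AE z in \<pi>. fst z \<in> A \<longrightarrow> f (fst z) + ctransform_snd c A f (snd z) = ereal (c z)"
      using tight[unfolded tight_def]
    proof (eventually_elim, intro impI antisym)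
      fix z assume eq: "f (fst z) + ctransform_snd c UNIV f (snd z) = ereal (c z)" and z: "fst z \<in> A"
      show "f (fst z) + ctransform_snd c A f (snd z) \<le> ereal (c z)"
        using c_concave_add_le[OF conc'[unfolded space] z] by (metis prod.collapse)
      \<comment> \<open>Fewer competitors can only raise the infimum. Together with the pointwise
        upper bound on \<open>A\<close>, this squeezes the sum to \<open>c z\<close>.\<close>
      have "ctransform_snd c UNIV f (snd z) \<le> ctransform_snd c A f (snd z)"
        unfolding ctransform_snd_def by (rule INF_superset_mono) auto
      then show "ereal (c z) \<le> f (fst z) + ctransform_snd c A f (snd z)"
        unfolding eq[symmetric] by (rule add_left_mono)
    qed
  qed
  moreover have "(\<integral>\<^sup>+z. ennreal (c z) \<partial>?\<rho>) < \<infinity>"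
    using opt fin c_meas_\<pi>
    by (intro restricted_plan_nn_integral_finite[OF \<pi> A(1) A']) (auto simp: optimal_plan_def)
  ultimately show ?thesis
    by (intro tight_imp_kantorovich_potential[OF c(2) c_meas' conc' f' fc' \<rho>])
qed

subsection \<open>Gluing along components\<close>

lemma msupport_components:
  fixes M :: "'a::second_countable_topology measure"
  assumes "sets M = sets borel" "A \<in> components (msupport M)"
  shows "A \<in> sets M" "closed A"
proof -
  have "closed (msupport M)"
    using closedin_msupport[of M] sets_eq_imp_space_eq[OF assms(1)] by simp
  then show "closed A" using assms(2) by (rule closed_components)
  then show "A \<in> sets M" using assms(1) by simp
qed

lemma disjoint_family_on_components:
  assumes "I \<subseteq> components S" shows "disjoint_family_on (\<lambda>A. A) I"
  using assms components_nonoverlap[of _ S] by (auto simp: disjoint_family_on_def)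

text \<open>Countability permits the exceptional null sets of all components to be discarded at
  once; up to a null set, each level set of \<open>H\<close> is then the union of the non-null
  components carrying that value.\<close>

lemma component_level_sets:
  fixes M :: "'a::second_countable_topology measure" and H :: "'a \<Rightarrow> real"
  assumes M: "prob_space M" "sets M = sets borel" and count: "countable (components (msupport M))"
    and const: "\<And>A. A \<in> components (msupport M) \<Longrightarrow> emeasure M A > 0 \<Longrightarrow>
      \<exists>a. AE x in M. x \<in> A \<longrightarrow> H x = a"
  obtains I where "\<And>\<alpha>. I \<alpha> \<subseteq> components (msupport M)"
    and "\<And>\<alpha> A. A \<in> I \<alpha> \<Longrightarrow> emeasure M A > 0"
    and "\<exists>\<alpha>. I \<alpha> \<noteq> {}"
    and "\<And>\<alpha>. AE x in M. x \<in> \<Union>(I \<alpha>) \<longleftrightarrow> H x = \<alpha>"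
proof -
  interpret prob_space M by fact
  let ?C = "components (msupport M)"
  obtain a where a: "AE x in M. x \<in> A \<longrightarrow> H x = a A" if "A \<in> ?C" "emeasure M A > 0" for A
    using const by metis
  have "AE x in M. x \<in> A \<longrightarrow> emeasure M A > 0 \<and> H x = a A" if A: "A \<in> ?C" for A
  proof (cases "emeasure M A > 0")
    case True
    with a[OF A] show ?thesis by simp
  next
    case False
    then have "AE x in M. x \<notin> A"
      using msupport_components(1)[OF M(2) A] by (intro AE_not_in) auto
    then show ?thesis by eventually_elim simp
  qed
  then have all: "AE x in M. \<forall>A\<in>?C. x \<in> A \<longrightarrow> emeasure M A > 0 \<and> H x = a A"
    using count by (simp add: AE_ball_countable)
  have supp: "AE x in M. x \<in> \<Union>?C"
    using AE_msupport[of M UNIV] M(2) by (simp add: finite_measure_axioms)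
  \<comment> \<open>The choice of \<open>a A\<close> is meaningful only on components of positive
    measure, so null components are left out.\<close>
  define I where "I \<alpha> = {A \<in> ?C. emeasure M A > 0 \<and> a A = \<alpha>}" for \<alpha>
  show ?thesis
  proof
    show "AE x in M. x \<in> \<Union>(I \<alpha>) \<longleftrightarrow> H x = \<alpha>" for \<alpha>
      using all supp
    proof eventually_elim
      case (elim x)
      then obtain A where A: "A \<in> ?C" "x \<in> A" by (metis UnionE)
      show ?case
      proof
        assume "x \<in> \<Union>(I \<alpha>)"
        then show "H x = \<alpha>" using elim(1) by (auto simp: I_def)
      next
        assume "H x = \<alpha>"
        then have "A \<in> I \<alpha>" using A elim(1) by (simp add: I_def)
        then show "x \<in> \<Union>(I \<alpha>)" using A(2) by (rule UnionI)
      qed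
    qed
    \<comment> \<open>Countably many null components cannot carry a probability measure.\<close>
    have "\<exists>A\<in>?C. emeasure M A > 0"
    proof (rule ccontr)
      assume none: "\<not> ?thesis"
      have "AE x in M. False" using all supp
      proof eventually_elim
        case (elim x)
        then obtain A where "A \<in> ?C" "x \<in> A" by (metis UnionE)
        then show False using elim(1) none by simp
      qed
      then show False by simp
    qed
    then show "\<exists>\<alpha>. I \<alpha> \<noteq> {}" by (auto simp: I_def)
  qed (auto simp: I_def)
qed

text \<open>For a value \<alpha> of \<open>E\<close> on some non-null component, let
  \<open>U\<close> and \<open>V\<close> be the unions of components where \<open>E\<close> and
  \<open>D\<close> equal \<alpha>. The plan couples \<open>U\<close> exactly with \<open>V\<close>,
  so \<open>\<mu>(U) = \<pi>(U \<times> V) = \<nu>(V)\<close>, and non-degeneracy leaves only mass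
  \<open>1\<close>.\<close>

lemma nondegenerate_imp_AE_const:
  fixes \<mu> :: "'a::second_countable_topology measure" and \<nu> :: "'b::second_countable_topology measure"
    and E :: "'a \<Rightarrow> real" and D :: "'b \<Rightarrow> real"
  assumes \<mu>: "prob_space \<mu>" "sets \<mu> = sets borel" and \<nu>: "prob_space \<nu>" "sets \<nu> = sets borel"
    and count: "countable (components (msupport \<mu>))" "countable (components (msupport \<nu>))"
    and \<pi>: "\<pi> \<in> transport_plans \<mu> \<nu>" "\<not> degenerate_plan \<mu> \<nu> \<pi>"
    and eq: "AE z in \<pi>. E (fst z) = D (snd z)"
    and E: "\<And>A. A \<in> components (msupport \<mu>) \<Longrightarrow> emeasure \<mu> A > 0 \<Longrightarrow>
      \<exists>a. AE x in \<mu>. x \<in> A \<longrightarrow> E x = a"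
    and D: "\<And>B. B \<in> components (msupport \<nu>) \<Longrightarrow> emeasure \<nu> B > 0 \<Longrightarrow>
      \<exists>b. AE y in \<nu>. y \<in> B \<longrightarrow> D y = b"
  shows "\<exists>a. AE x in \<mu>. E x = a"
proof -
  interpret \<mu>: prob_space \<mu> by fact
  interpret \<nu>: prob_space \<nu> by fact
  obtain I where I: "\<And>\<alpha>. I \<alpha> \<subseteq> components (msupport \<mu>)"
    "\<And>\<alpha> A. A \<in> I \<alpha> \<Longrightarrow> emeasure \<mu> A > 0" "\<exists>\<alpha>. I \<alpha> \<noteq> {}"
    "\<And>\<alpha>. AE x in \<mu>. x \<in> \<Union>(I \<alpha>) \<longleftrightarrow> E x = \<alpha>"
    using component_level_sets[OF \<mu> count(1) E] by blast
  obtain J where J: "\<And>\<alpha>. J \<alpha> \<subseteq> components (msupport \<nu>)"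
    "\<And>\<alpha>. AE y in \<nu>. y \<in> \<Union>(J \<alpha>) \<longleftrightarrow> D y = \<alpha>"
    using component_level_sets[OF \<nu> count(2) D] by metis
  obtain \<alpha> A\<^sub>0 where A\<^sub>0: "A\<^sub>0 \<in> I \<alpha>" using I(3) by auto
  define U where "U = \<Union>(I \<alpha>)"
  define V where "V = \<Union>(J \<alpha>)"
  have countI: "countable (I \<alpha>)" and countJ: "countable (J \<alpha>)"
    using countable_subset[OF I(1) count(1)] countable_subset[OF J(1) count(2)] by blast+
  have setsI: "A \<in> sets \<mu>" if "A \<in> I \<alpha>" for A
    using that I(1) msupport_components(1)[OF \<mu>(2)] by blast
  have setsJ: "B \<in> sets \<nu>" if "B \<in> J \<alpha>" for B
    using that J(1) msupport_components(1)[OF \<nu>(2)] by blast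
  have U: "U \<in> sets \<mu>" and V: "V \<in> sets \<nu>"
    unfolding U_def V_def using countI countJ setsI setsJ by (auto intro!: sets.countable_Union)
  have sumI: "(\<Sum>\<^sub>\<infinity>A\<in>I \<alpha>. emeasure \<mu> A) = emeasure \<mu> U"
    using emeasure_Union_infsum[OF countI, of "\<lambda>A. A" \<mu>] setsI
      disjoint_family_on_components[OF I(1)] by (simp add: U_def)
  have sumJ: "(\<Sum>\<^sub>\<infinity>B\<in>J \<alpha>. emeasure \<nu> B) = emeasure \<nu> V"
    using emeasure_Union_infsum[OF countJ, of "\<lambda>B. B" \<nu>] setsJ
      disjoint_family_on_components[OF J(1)] by (simp add: V_def)
  have sets_\<pi>: "S \<times> T \<in> sets \<pi>" if "S \<in> sets \<mu>" "T \<in> sets \<nu>" for S T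
    using that by (rule transport_plans_times_sets[OF \<pi>(1)])
  have "(\<Sum>\<^sub>\<infinity>B\<in>J \<alpha>. emeasure \<pi> (A \<times> B)) = emeasure \<pi> (A \<times> V)" if "A \<in> I \<alpha>" for A
  proof -
    have "(\<Sum>\<^sub>\<infinity>B\<in>J \<alpha>. emeasure \<pi> (A \<times> B)) = emeasure \<pi> (\<Union>B\<in>J \<alpha>. A \<times> B)"
    proof (rule emeasure_Union_infsum[OF countJ])
      show "A \<times> B \<in> sets \<pi>" if "B \<in> J \<alpha>" for B
        by (rule sets_\<pi>[OF setsI[OF \<open>A \<in> I \<alpha>\<close>] setsJ[OF that]])
      show "disjoint_family_on (\<lambda>B. A \<times> B) (J \<alpha>)"
        using disjoint_family_on_components[OF J(1), of \<alpha>]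
        by (simp add: disjoint_family_on_def Times_Int_Times)
    qed
    also have "(\<Union>B\<in>J \<alpha>. A \<times> B) = A \<times> V" by (auto simp: V_def)
    finally show ?thesis .
  qed
  then have "(\<Sum>\<^sub>\<infinity>A\<in>I \<alpha>. \<Sum>\<^sub>\<infinity>B\<in>J \<alpha>. emeasure \<pi> (A \<times> B)) = (\<Sum>\<^sub>\<infinity>A\<in>I \<alpha>. emeasure \<pi> (A \<times> V))"
    by (intro infsum_cong)
  also have "\<dots> = emeasure \<pi> (\<Union>A\<in>I \<alpha>. A \<times> V)"
  proof (rule emeasure_Union_infsum[OF countI])
    show "A \<times> V \<in> sets \<pi>" if "A \<in> I \<alpha>" for A
      by (rule sets_\<pi>[OF setsI[OF that] V])
    show "disjoint_family_on (\<lambda>A. A \<times> V) (I \<alpha>)"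
      using disjoint_family_on_components[OF I(1), of \<alpha>]
      by (simp add: disjoint_family_on_def Times_Int_Times)
  qed
  also have "(\<Union>A\<in>I \<alpha>. A \<times> V) = U \<times> V" by (auto simp: U_def)
  finally have sumIJ: "(\<Sum>\<^sub>\<infinity>A\<in>I \<alpha>. \<Sum>\<^sub>\<infinity>B\<in>J \<alpha>. emeasure \<pi> (A \<times> B)) = emeasure \<pi> (U \<times> V)" .
  \<comment> \<open>Almost surely \<open>fst z \<in> U\<close> means
    \<open>E (fst z) = \<alpha>\<close> and \<open>snd z \<in> V\<close> means
    \<open>D (snd z) = \<alpha>\<close>; \<open>eq\<close> identifies the two.\<close>
  have "AE z in \<pi>. fst z \<in> U \<longleftrightarrow> snd z \<in> V"
    using transport_plans_AE_fst[OF \<pi>(1) I(4)[of \<alpha>]] transport_plans_AE_snd[OF \<pi>(1) J(2)[of \<alpha>]] eq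
    unfolding U_def V_def by eventually_elim auto
  note UV = this AE_space
  have "emeasure \<pi> (U \<times> V) = emeasure \<pi> (U \<times> space \<nu>)"
  proof (rule emeasure_eq_AE)
    show "AE z in \<pi>. z \<in> U \<times> V \<longleftrightarrow> z \<in> U \<times> space \<nu>"
      using UV by eventually_elim (auto simp: transport_plansD(3)[OF \<pi>(1)] mem_Times_iff)
  qed (use sets_\<pi> U V in auto)
  then have UV\<mu>: "emeasure \<pi> (U \<times> V) = emeasure \<mu> U"
    using transport_plans_emeasure_fst[OF \<pi>(1) U] by simp
  have "emeasure \<pi> (U \<times> V) = emeasure \<pi> (space \<mu> \<times> V)"
  proof (rule emeasure_eq_AE)
    show "AE z in \<pi>. z \<in> U \<times> V \<longleftrightarrow> z \<in> space \<mu> \<times> V"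
      using UV by eventually_elim (auto simp: transport_plansD(3)[OF \<pi>(1)] mem_Times_iff)
  qed (use sets_\<pi> U V in auto)
  then have UV\<nu>: "emeasure \<pi> (U \<times> V) = emeasure \<nu> V"
    using transport_plans_emeasure_snd[OF \<pi>(1) V] by simp
  have "0 < emeasure \<mu> A\<^sub>0" using I(2)[OF A\<^sub>0] .
  also have "\<dots> \<le> emeasure \<mu> U" using A\<^sub>0 U by (intro emeasure_mono) (auto simp: U_def)
  finally have pos: "0 < emeasure \<mu> U" .
  have "\<not> emeasure \<nu> V < 1"
  proof
    assume "emeasure \<nu> V < 1"
    then have "degenerate_plan \<mu> \<nu> \<pi>"
      unfolding degenerate_plan_def using I(1) J(1) pos UV\<mu> UV\<nu>
      by (intro exI[of _ "I \<alpha>"] exI[of _ "J \<alpha>"]) (simp add: sumI sumJ sumIJ)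
    then show False using \<pi>(2) by contradiction
  qed
  then have "emeasure \<mu> U = 1"
    using UV\<mu> UV\<nu> \<mu>.emeasure_le_1[of U] by simp
  then have "AE x in \<mu>. x \<in> U"
    using U by (simp add: \<mu>.emeasure_eq_measure \<mu>.prob_eq_1)
  then have "AE x in \<mu>. E x = \<alpha>"
    using I(4)[of \<alpha>] unfolding U_def by eventually_elim simp
  then show ?thesis ..
qed

text \<open>Continuity turns the almost sure restriction to \<open>F\<close> into a pointwise one on
  the support. A finite connected image has at most one point.\<close>

lemma AE_const_of_finite_values:
  fixes \<nu> :: "'b::second_countable_topology measure" and D :: "'b \<Rightarrow> real"
  assumes \<nu>: "finite_measure \<nu>" "sets \<nu> = sets borel" and B: "closed B"
    and cont: "continuous_on B D" and F: "finite F" and val: "AE y in \<nu>. y \<in> B \<longrightarrow> D y \<in> F"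
    and conn: "connected (msupport (restrict_space \<nu> B))"
  shows "\<exists>b. AE y in \<nu>. y \<in> B \<longrightarrow> D y = b"
proof -
  interpret finite_measure \<nu> by fact
  let ?S = "msupport (restrict_space \<nu> B)"
  have sp: "space \<nu> = UNIV" using sets_eq_imp_space_eq[OF \<nu>(2)] by simp
  have Bs: "B \<in> sets \<nu>" using B \<nu>(2) by simp
  have space: "space (restrict_space \<nu> B) = B" by (simp add: space_restrict_space sp)
  \<comment> \<open>A preimage of a finite set under a continuous map, hence relatively closed. It
    has full measure in \<open>B\<close> and therefore contains the support.\<close>
  define W where "W = {y \<in> B. D y \<in> F}"
  have W: "closedin (top_of_set B) W"
    using continuous_closedin_preimage[OF cont finite_imp_closed[OF F]]
    by (simp add: W_def vimage_def Int_def)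
  then have "closed W" using B closedin_closed_trans by blast
  then have Ws: "W \<in> sets \<nu>" using \<nu>(2) by simp
  have "emeasure \<nu> W = emeasure \<nu> B"
    using val Bs Ws by (intro emeasure_eq_AE) (auto simp: W_def)
  then have "emeasure (restrict_space \<nu> B) W = emeasure (restrict_space \<nu> B) B"
    using Bs by (simp add: emeasure_restrict_space W_def sp)
  then have SW: "?S \<subseteq> W"
    unfolding msupport_def using W by (intro Inter_lower) (simp add: space)
  have "connected (D ` ?S)"
    using SW by (intro connected_continuous_image conn continuous_on_subset[OF cont]) (auto simp: W_def)
  moreover have "finite (D ` ?S)"
    using SW F by (auto simp: W_def intro: finite_subset[of _ F])
  \<comment> \<open>An inclusion rather than an equation, because the support is empty when
    \<open>B\<close> is a null set.\<close>
  ultimately obtain b where b: "D ` ?S \<subseteq> {b}"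
    by (metis connected_finite_iff_sing empty_subsetI order_refl)
  have "AE y in restrict_space \<nu> B. y \<in> ?S"
  proof (rule AE_msupport)
    show "finite_measure (restrict_space \<nu> B)"
      by (rule finite_measure_restrict_space) (simp_all add: Bs sp finite_measure_axioms)
    show "sets (restrict_space \<nu> B) = sets (restrict_space borel B)"
      using \<nu>(2) by (rule sets_restrict_space_cong)
  qed
  then have "AE y in \<nu>. y \<in> B \<longrightarrow> y \<in> ?S"
    using Bs by (subst (asm) AE_restrict_space_iff) (auto simp: sp)
  then have "AE y in \<nu>. y \<in> B \<longrightarrow> D y = b"
    by eventually_elim (use b in auto)
  then show ?thesis ..
qed

text \<open>Almost every point of \<open>B\<close> is reached by \<open>\<pi>\<close> from a
  component \<open>A\<close> with \<open>A \<times> B\<close> non-null, and there \<open>D\<close>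
  has the constant value of \<open>E\<close> on \<open>A\<close>. Only finitely many such
  \<open>A\<close> exist, so \<open>AE_const_of_finite_values\<close> applies.\<close>

lemma linked_AE_const_on_component:
  fixes \<mu> :: "'a::second_countable_topology measure" and \<nu> :: "'b::second_countable_topology measure"
    and E :: "'a \<Rightarrow> real" and D :: "'b \<Rightarrow> real"
  assumes \<mu>: "prob_space \<mu>" "sets \<mu> = sets borel" and \<nu>: "prob_space \<nu>" "sets \<nu> = sets borel"
    and count: "countable (components (msupport \<mu>))"
    and \<pi>: "\<pi> \<in> transport_plans \<mu> \<nu>"
    and eq: "AE z in \<pi>. E (fst z) = D (snd z)" and D: "D \<in> borel_measurable \<nu>"
    and E: "\<And>A. A \<in> components (msupport \<mu>) \<Longrightarrow> emeasure \<mu> A > 0 \<Longrightarrow>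
      \<exists>a. AE x in \<mu>. x \<in> A \<longrightarrow> E x = a"
    and B: "B \<in> components (msupport \<nu>)"
    and fin: "finite {A \<in> components (msupport \<mu>). emeasure \<pi> (A \<times> B) > 0}"
    and cont: "continuous_on B D" and conn: "connected (msupport (restrict_space \<nu> B))"
  shows "\<exists>b. AE y in \<nu>. y \<in> B \<longrightarrow> D y = b"
proof -
  interpret \<mu>: prob_space \<mu> by fact
  interpret \<nu>: prob_space \<nu> by fact
  let ?X = "components (msupport \<mu>)"
  note Bs = msupport_components[OF \<nu>(2) B]
  obtain a where a: "AE x in \<mu>. x \<in> A \<longrightarrow> E x = a A" if "A \<in> ?X" "emeasure \<mu> A > 0" for A
    using E by metis
  \<comment> \<open>The constants of the components coupled with \<open>B\<close>. Each is
    meaningful, since \<open>\<pi>(A \<times> B) > 0\<close> forces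
    \<open>\<mu>(A) > 0\<close>.\<close>
  define F where "F = a ` {A \<in> ?X. emeasure \<pi> (A \<times> B) > 0}"
  have finF: "finite F" unfolding F_def using fin by (rule finite_imageI)
  have "AE z in \<pi>. z \<in> A \<times> B \<longrightarrow> D (snd z) \<in> F" if A: "A \<in> ?X" for A
  proof (cases "emeasure \<pi> (A \<times> B) > 0")
    case True
    note As = msupport_components(1)[OF \<mu>(2) A]
    have "emeasure \<pi> (A \<times> B) \<le> emeasure \<pi> (A \<times> space \<nu>)"
    proof (rule emeasure_mono)
      show "A \<times> space \<nu> \<in> sets \<pi>" using As by (rule transport_plans_times_sets[OF \<pi>]) simp
    qed (use sets.sets_into_space[OF Bs(1)] in auto)
    with True have "emeasure \<mu> A > 0"
      unfolding transport_plans_emeasure_fst[OF \<pi> As] by (rule less_le_trans)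
    from transport_plans_AE_fst[OF \<pi> a[OF A this]] eq show ?thesis
    proof eventually_elim
      case (elim z)
      have "a A \<in> F" unfolding F_def using A True by (intro imageI) simp
      then show ?case using elim by (metis mem_Times_iff)
    qed
  next
    case False
    then have "AE z in \<pi>. z \<notin> A \<times> B"
      using transport_plans_times_sets[OF \<pi> msupport_components(1)[OF \<mu>(2) A] Bs(1)]
      by (intro AE_not_in) (simp add: null_sets_def)
    then show ?thesis by eventually_elim simp
  qed
  then have "AE z in \<pi>. \<forall>A\<in>?X. z \<in> A \<times> B \<longrightarrow> D (snd z) \<in> F"
    unfolding AE_ball_countable[OF count] by blast
  moreover have "AE x in \<mu>. x \<in> msupport \<mu>"
    using AE_msupport[of \<mu> UNIV] \<mu>(2) \<mu>.finite_measure_axioms by simp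
  then have "AE z in \<pi>. fst z \<in> msupport \<mu>" by (rule transport_plans_AE_fst[OF \<pi>])
  ultimately have AE_\<pi>: "AE z in \<pi>. snd z \<in> B \<longrightarrow> D (snd z) \<in> F"
  proof eventually_elim
    case (elim z)
    then obtain A where "A \<in> ?X" "fst z \<in> A" by (metis Union_components UnionE)
    then show ?case using elim(1) by (metis mem_Times_iff)
  qed
  \<comment> \<open>Measurability of the condition is what allows it to descend from
    \<open>\<pi>\<close> to \<open>\<nu>\<close>.\<close>
  have "F \<in> sets borel" using finite_imp_closed[OF finF] by simp
  then have "{y \<in> space \<nu>. y \<in> B \<longrightarrow> D y \<in> F} \<in> sets \<nu>"
    using D Bs(1) by measurable
  from AE_\<pi>[unfolded transport_plans_AE_snd_iff[OF \<pi> this]] show ?thesis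
    by (rule AE_const_of_finite_values[OF \<nu>.finite_measure_axioms \<nu>(2) Bs(2) cont finF _ conn])
qed

text \<open>The second conjunct of the conclusion expresses the parenthetical claim of case 2, that
  regularity of the transforms is automatic when the non-null components are points.\<close>

theorem corollary1:
  fixes \<mu> :: "'a::polish_space measure"
    and \<nu> :: "'b::polish_space measure"
    and c :: "'a \<times> 'b \<Rightarrow> real"
    and \<pi> :: "('a \<times> 'b) measure"
  assumes "prob_space \<mu>" and "sets \<mu> = sets borel"
    and "prob_space \<nu>" and "sets \<nu> = sets borel"
    and "continuous_on UNIV c" and "\<And>z. c z \<ge> 0"
    and "transport_cost c \<mu> \<nu> < \<infinity>"
    and "countable (components (msupport \<mu>))"
    and "countable (components (msupport \<nu>))"
    and "optimal_plan c \<mu> \<nu> \<pi>"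
    and "\<not> degenerate_plan \<mu> \<nu> \<pi>"
    and "\<And>A. A \<in> components (msupport \<mu>) \<Longrightarrow> emeasure \<mu> A > 0 \<Longrightarrow>
           unique_potentials c (restricted_fst \<mu> A) (restricted_snd \<mu> \<nu> \<pi> A)"
    and "(regular_transforms c \<mu> \<nu> \<and>
          (\<forall>B\<in>components (msupport \<nu>).
             finite {A \<in> components (msupport \<mu>). emeasure \<pi> (A \<times> B) > 0})) \<or>
         (\<forall>B\<in>components (msupport \<nu>). emeasure \<nu> B > 0 \<longrightarrow> is_singleton B)"
  shows "unique_potentials c \<mu> \<nu> \<and>
         ((\<forall>B\<in>components (msupport \<nu>). emeasure \<nu> B > 0 \<longrightarrow> is_singleton B) \<longrightarrow>
            regular_transforms c \<mu> \<nu>)"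
proof -
  note \<mu> = assms(2) and \<nu> = assms(4) and c = assms(5,6) and fin = assms(7) and opt = assms(10)
  let ?X = "components (msupport \<mu>)" and ?Y = "components (msupport \<nu>)"
  let ?tr = "ctransform_snd c UNIV"
  interpret \<mu>: prob_space \<mu> by fact
  interpret \<nu>: prob_space \<nu> by fact
  have sp: "space \<mu> = UNIV" "space \<nu> = UNIV"
    using sets_eq_imp_space_eq[OF \<mu>] sets_eq_imp_space_eq[OF \<nu>] by auto
  have \<pi>: "\<pi> \<in> transport_plans \<mu> \<nu>" using opt by (simp add: optimal_plan_def)
  have "c \<in> borel_measurable (borel \<Otimes>\<^sub>M borel)"
    using c(1) by (simp add: borel_prod borel_measurable_continuous_onI)
  then have c_meas: "c \<in> borel_measurable (\<mu> \<Otimes>\<^sub>M \<nu>)"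
    unfolding measurable_cong_sets[OF sets_pair_measure_cong[OF \<mu> \<nu>] refl] .
  have tr_meas: "?tr f \<in> borel_measurable \<nu>" if "f \<in> kantorovich_potentials c \<mu> \<nu>" for f
    using that ctransform_snd_measurable[OF c(1), of UNIV f] unfolding measurable_cong_sets[OF \<nu> refl]
    by (auto simp: kantorovich_potentials_def c_concave_def sp)
  have potential: "c_concave c UNIV UNIV f" "f \<in> borel_measurable borel" "tight c UNIV f \<pi>"
    "AE x in \<mu>. \<bar>f x\<bar> \<noteq> \<infinity>" "AE y in \<nu>. \<bar>?tr f y\<bar> \<noteq> \<infinity>"
    if f: "f \<in> kantorovich_potentials c \<mu> \<nu>" for f
  proof -
    show conc: "c_concave c UNIV UNIV f"
      using f by (simp add: kantorovich_potentials_def sp)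
    then obtain g where g: "\<forall>y. g y \<noteq> \<infinity>" "\<forall>x. f x = ctransform_fst c UNIV g x"
      by (auto simp: c_concave_def)
    \<comment> \<open>The space of \<open>\<mu>\<close> is the whole type, so the representation
      holds everywhere and \<open>f\<close> inherits Borel measurability from the transform.\<close>
    then have "f = ctransform_fst c UNIV g" by auto
    then show f_meas: "f \<in> borel_measurable borel"
      using ctransform_fst_measurable[OF c(1), of UNIV g] g(1) by simp
    have "f \<in> borel_measurable \<mu>"
      using f_meas unfolding measurable_cong_sets[OF \<mu> refl] .
    with conc c_meas c(2) tr_meas[OF f]
    have hyps: "\<And>z. c z \<ge> 0" "c \<in> borel_measurable (\<mu> \<Otimes>\<^sub>M \<nu>)"
      "c_concave c (space \<mu>) (space \<nu>) f" "f \<in> borel_measurable \<mu>"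
      "ctransform_snd c (space \<mu>) f \<in> borel_measurable \<nu>"
      by (auto simp: sp)
    have tight: "tight c (space \<mu>) f \<pi>"
      by (rule kantorovich_potential_tight[OF hyps f fin opt])
    then show "tight c UNIV f \<pi>" by (simp add: sp)
    show "AE x in \<mu>. \<bar>f x\<bar> \<noteq> \<infinity>" "AE y in \<nu>. \<bar>?tr f y\<bar> \<noteq> \<infinity>"
      using tight_AE_real[OF hyps \<pi> tight] by (simp_all add: sp)
  qed

  \<comment> \<open>The single point of such a component is an atom, so the transform, being finite
    almost everywhere, is finite there. Continuity and connectedness are trivial on a point.\<close>
  have singleton: "regular_transforms c \<mu> \<nu>"
    if single: "\<forall>B\<in>?Y. emeasure \<nu> B > 0 \<longrightarrow> is_singleton B"
    unfolding regular_transforms_def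
  proof (intro ballI impI)
    fix f B assume f: "f \<in> kantorovich_potentials c \<mu> \<nu>" and B: "B \<in> ?Y" "emeasure \<nu> B > 0"
    obtain b where b: "B = {b}" using single B by (auto simp: is_singleton_def)
    have "\<bar>?tr f b\<bar> \<noteq> \<infinity>"
    proof
      assume "\<bar>?tr f b\<bar> = \<infinity>"
      with potential(5)[OF f] have "AE y in \<nu>. y \<notin> B"
        unfolding b by (auto elim!: eventually_mono)
      then have "B \<in> null_sets \<nu>"
        using msupport_components(1)[OF \<nu> B(1)] by (simp add: AE_iff_null_sets)
      then show False using B(2) by auto
    qed
    moreover have "msupport (restrict_space \<nu> B) \<subseteq> {b}"
      using closedin_imp_subset[OF closedin_msupport[of "restrict_space \<nu> B"]]
      by (simp add: space_restrict_space sp b)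
    then have "msupport (restrict_space \<nu> B) = {} \<or> msupport (restrict_space \<nu> B) = {b}"
      by (rule subset_singletonD)
    then have "connected (msupport (restrict_space \<nu> B))" by auto
    ultimately show "real_continuous_on B (ctransform_snd c (space \<mu>) f) \<and>
        connected (msupport (restrict_space \<nu> B))"
      by (simp add: real_continuous_on_def b sp)
  qed

  have "\<exists>a::real. AE x in \<mu>. f1 x - f2 x = ereal a"
    if f1: "f1 \<in> kantorovich_potentials c \<mu> \<nu>" and f2: "f2 \<in> kantorovich_potentials c \<mu> \<nu>" for f1 f2
  proof -
    define E where "E x = real_of_ereal (f1 x) - real_of_ereal (f2 x)" for x
    \<comment> \<open>The order of \<open>f1\<close> and \<open>f2\<close> is reversed relative to
      \<open>E\<close>: equating the two tight identities for \<open>c z\<close> gives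
      \<open>E (fst z) = D (snd z)\<close> without a sign.\<close>
    define D where "D y = real_of_ereal (?tr f2 y) - real_of_ereal (?tr f1 y)" for y
    have fE: "AE x in \<mu>. f1 x - f2 x = ereal (E x)"
      using potential(4)[OF f1] potential(4)[OF f2]
      by eventually_elim (auto simp: E_def ereal_real simp flip: ereal_minus(1))
    have ED: "AE z in \<pi>. E (fst z) = D (snd z)"
      using transport_plans_AE_fst[OF \<pi> potential(4)[OF f1]] transport_plans_AE_fst[OF \<pi> potential(4)[OF f2]]
        transport_plans_AE_snd[OF \<pi> potential(5)[OF f1]] transport_plans_AE_snd[OF \<pi> potential(5)[OF f2]]
        potential(3)[OF f1, unfolded tight_def] potential(3)[OF f2, unfolded tight_def]
    proof eventually_elim
      case (elim z)
      then show ?case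
        by (cases "f1 (fst z)"; cases "f2 (fst z)"; cases "?tr f1 (snd z)"; cases "?tr f2 (snd z)")
          (auto simp: E_def D_def)
    qed
    \<comment> \<open>Both potentials are potentials of the problem restricted to \<open>A\<close>,
      where uniqueness is assumed.\<close>
    have E_const: "\<exists>a. AE x in \<mu>. x \<in> A \<longrightarrow> E x = a" if A: "A \<in> ?X" "emeasure \<mu> A > 0" for A
    proof -
      note As = msupport_components(1)[OF \<mu> A(1)]
      have "f \<in> kantorovich_potentials c (restricted_fst \<mu> A) (restricted_snd \<mu> \<nu> \<pi> A)"
        if "f \<in> kantorovich_potentials c \<mu> \<nu>" for f
        using restricted_kantorovich_potential[OF assms(1) \<mu> \<nu> c fin opt As A(2) potential(1-3)[OF that]] .
      then obtain a where "AE x in restricted_fst \<mu> A. f1 x - f2 x = ereal a"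
        using assms(12)[OF A] f1 f2 unfolding unique_potentials_def by blast
      then have "AE x in \<mu>. x \<in> A \<longrightarrow> f1 x - f2 x = ereal a"
        using A(2) by (intro restricted_fst_AE[OF \<pi> As]) auto
      with fE have "AE x in \<mu>. x \<in> A \<longrightarrow> E x = a"
        by eventually_elim auto
      then show ?thesis ..
    qed
    have D_const: "\<exists>b. AE y in \<nu>. y \<in> B \<longrightarrow> D y = b" if B: "B \<in> ?Y" "emeasure \<nu> B > 0" for B
      using assms(13)
    proof (elim disjE conjE)
      assume "\<forall>B\<in>?Y. emeasure \<nu> B > 0 \<longrightarrow> is_singleton B"
      then obtain b where "B = {b}" using B by (auto simp: is_singleton_def)
      then show ?thesis by auto
    next
      assume reg: "regular_transforms c \<mu> \<nu>"
        and finX: "\<forall>B\<in>?Y. finite {A \<in> ?X. emeasure \<pi> (A \<times> B) > 0}"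
      \<comment> \<open>Finiteness at every point of \<open>B\<close>, part of
        \<open>real_continuous_on\<close>, converts continuity into the extended reals to continuity
        of the real part, so that differences may be formed.\<close>
      have cont: "continuous_on B (\<lambda>y. real_of_ereal (?tr f y))"
        if f: "f \<in> kantorovich_potentials c \<mu> \<nu>" for f
      proof -
        have *: "(\<forall>y\<in>B. \<bar>?tr f y\<bar> \<noteq> \<infinity>) \<and> continuous_on B (?tr f)"
          using reg[unfolded regular_transforms_def real_continuous_on_def sp, rule_format, OF f B]
          by auto
        have "\<bar>?tr f y\<bar> \<noteq> \<infinity>" if "y \<in> B" for y
          by (rule bspec[OF conjunct1[OF *] that])
        then show ?thesis
          by (rule iffD1[OF continuous_on_iff_real[unfolded o_def] conjunct2[OF *]])
      qed
      have D_meas: "D \<in> borel_measurable \<nu>"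
        unfolding D_def using tr_meas[OF f1] tr_meas[OF f2] by measurable
      have D_cont: "continuous_on B D"
        unfolding D_def by (intro continuous_on_diff cont f1 f2)
      have conn: "connected (msupport (restrict_space \<nu> B))"
        using reg[unfolded regular_transforms_def, rule_format, OF f1 B] by simp
      show ?thesis
        by (rule linked_AE_const_on_component[OF assms(1-4,8) \<pi> ED D_meas E_const B(1)
              bspec[OF finX B(1)] D_cont conn])
    qed
    obtain a where "AE x in \<mu>. E x = a"
      using nondegenerate_imp_AE_const[OF assms(1,2,3,4,8,9) \<pi> assms(11) ED E_const D_const] by blast
    with fE have "AE x in \<mu>. f1 x - f2 x = ereal a" by eventually_elim simp
    then show ?thesis ..
  qed
  then have "unique_potentials c \<mu> \<nu>" unfolding unique_potentials_def by (intro ballI)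
  with singleton show ?thesis by (intro conjI impI)
qed

end
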